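(* Let $k\ge 2$ and $n\ge 20k^2$ be integers. Let $G$ be a connected graph on $n$ vertices with at most $\left(1+\frac{1}{54k^2}\right)n$ edges. Then $$r(G,P_k)=\max\left\{n+\lfloor k/2\rfloor-1,\; n+k-2-\alpha'(G)-\gamma\right\},$$ where $\gamma=0$ if $k-1$ divides $n+k-3-\alpha'(G)$, and $\gamma=1$ otherwise.
   Context: All graphs are finite and simple. For graphs $H_1,H_2$, the Ramsey number $r(H_1,H_2)$ is the smallest positive integer $N$ such that every graph $\Gamma$ on $N$ vertices contains $H_1$ as a (not necessarily induced) subgraph or its complement $\overline{\Gamma}$ contains $H_2$ as a subgraph. $P_k$ is the path on $k$ vertices. For a vertex $v$ of $G$, $G_v$ is the subgraph of $G$ obtained by deleting $v$ and all neighbors of $v$. $\alpha'(G)$ is the minimum, over all vertices $v$ of $G$, of the independence number of $G_v$ (the empty graph has independence number $0$). *)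

theory Defs
  imports Complex_Main "HOL-Library.Ramsey"
begin

record 'a ugraph =
  verts :: "'a set"
  edges :: "'a set set"

definition simple_graph :: "'a ugraph \<Rightarrow> bool" where
  "simple_graph G \<longleftrightarrow> finite (verts G) \<and> edges G \<subseteq> [verts G]\<^bsup>2\<^esup>"

definition complement_graph :: "'a ugraph \<Rightarrow> 'a ugraph" where
  "complement_graph G = \<lparr>verts = verts G, edges = [verts G]\<^bsup>2\<^esup> - edges G\<rparr>"

definition induced_subgraph :: "'a ugraph \<Rightarrow> 'a set \<Rightarrow> 'a ugraph" where
  "induced_subgraph G S = \<lparr>verts = verts G \<inter> S, edges = {e \<in> edges G. e \<subseteq> S}\<rparr>"

definition neighbors :: "'a ugraph \<Rightarrow> 'a \<Rightarrow> 'a set" where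
  "neighbors G v = {w \<in> verts G. {v, w} \<in> edges G}"

definition connected_graph :: "'a ugraph \<Rightarrow> bool" where
  "connected_graph G \<longleftrightarrow> verts G \<noteq> {} \<and>
     (\<forall>u\<in>verts G. \<forall>v\<in>verts G. (u, v) \<in> {(x, y). {x, y} \<in> edges G}\<^sup>*)"

(* H occurs in G as a not necessarily induced subgraph, up to isomorphism. *)
definition contains_graph :: "'a ugraph \<Rightarrow> 'b ugraph \<Rightarrow> bool" where
  "contains_graph G H \<longleftrightarrow>
     (\<exists>f. inj_on f (verts H) \<and> f ` verts H \<subseteq> verts G \<and> (\<forall>e\<in>edges H. f ` e \<in> edges G))"

(* Host graphs live on finite sets of naturals, which covers all finite graphs
   up to isomorphism. *)
definition ramsey_number :: "'a ugraph \<Rightarrow> 'b ugraph \<Rightarrow> nat" where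
  "ramsey_number H1 H2 =
     (LEAST N. N > 0 \<and>
        (\<forall>\<Gamma> :: nat ugraph. simple_graph \<Gamma> \<and> card (verts \<Gamma>) = N \<longrightarrow>
           contains_graph \<Gamma> H1 \<or> contains_graph (complement_graph \<Gamma>) H2))"

definition path_graph :: "nat \<Rightarrow> nat ugraph" where
  "path_graph k = \<lparr>verts = {..<k}, edges = {{i, Suc i} | i. Suc i < k}\<rparr>"

definition independence_number :: "'a ugraph \<Rightarrow> nat" where
  "independence_number G = Max {card S | S. S \<subseteq> verts G \<and> indep S (edges G)}"

definition delete_closed_nbhd :: "'a ugraph \<Rightarrow> 'a \<Rightarrow> 'a ugraph" where
  "delete_closed_nbhd G v = induced_subgraph G (verts G - insert v (neighbors G v))"

definition alpha' :: "'a ugraph \<Rightarrow> nat" where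
  "alpha' G = Min ((\<lambda>v. independence_number (delete_closed_nbhd G v)) ` verts G)"

end

theory Submission
  imports Defs "HOL-Library.Disjoint_Sets"
begin

text \<open>For the upper bound let \<open>B\<close> be the complement of the host, a graph without \<open>P\<^sub>k\<close> on \<open>N\<close> vertices, and
  let \<open>r = \<lfloor>k/2\<rfloor>\<close>. Then \<open>B\<close> has average degree at most \<open>k - 2\<close>, so most vertices are low, that is of
  degree at most \<open>d\<close>, about \<open>5k/2\<close>. The guest \<open>G\<close> is so sparse that, up to a tiny core, its vertices
  can be ordered with at most two earlier neighbours each. Hence it can be embedded greedily into low
  vertices as long as a fixed fraction of its vertices is kept aside; these are placed at the end by
  Hall's theorem, where a violation yields a large complete bipartite subgraph of \<open>B\<close>.

  If \<open>G\<close> has many leaves, the leaves are kept aside. A violation then means that almost all leaves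
  hang on at most \<open>r\<close> vertices with \<open>r\<close> common neighbours in \<open>B\<close>. This is impossible unless some hub
  has more than \<open>d\<close> leaves, and also if such a hub sits on a vertex of degree less than \<open>r\<close>. If there is
  no vertex of degree less than \<open>r\<close>, then all components of \<open>B\<close> have at most \<open>k - 1\<close> vertices, and the
  term with \<open>alpha' G\<close> is exactly what is needed to fill up the component of the hub. If \<open>G\<close> has few
  leaves, then most of its vertices lie inside long paths of vertices of degree two; an independent set
  of such vertices is kept aside, and the vertices of high degree in \<open>B\<close> are handled first.

  The lower bounds come from two disjoint cliques of orders \<open>n - 1\<close> and \<open>r - 1\<close>, and from a complete
  multipartite graph with classes of size \<open>k - 1\<close> and \<open>k - 2\<close>: the class of a vertex \<open>v\<close> of \<open>G\<close> contains
  at most \<open>1 + \<alpha>(G\<^sub>v)\<close> vertices of \<open>G\<close>.\<close>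

section \<open>Graphs without a path on \<open>k\<close> vertices\<close>

definition nbs :: "('a \<Rightarrow> 'a \<Rightarrow> bool) \<Rightarrow> 'a set \<Rightarrow> 'a \<Rightarrow> 'a set" where
  "nbs E T x = {y \<in> T. E x y}"

text \<open>Twice the number of edges of the graph induced on \<open>T\<close>, for symmetric
  irreflexive \<open>E\<close>.\<close>

definition degsum :: "('a \<Rightarrow> 'a \<Rightarrow> bool) \<Rightarrow> 'a set \<Rightarrow> nat" where
  "degsum E T = (\<Sum>x\<in>T. card (nbs E T x))"

lemma in_nbs_iff [simp]: "y \<in> nbs E T x \<longleftrightarrow> y \<in> T \<and> E x y"
  by (simp add: nbs_def)

lemma finite_nbs [simp]: "finite T \<Longrightarrow> finite (nbs E T x)"
  by (simp add: nbs_def)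

lemma nbs_subset: "nbs E T x \<subseteq> T"
  by auto

lemma card_nbs_mono: "finite T \<Longrightarrow> S \<subseteq> T \<Longrightarrow> card (nbs E S x) \<le> card (nbs E T x)"
  by (rule card_mono) auto

locale fin_graph =
  fixes V :: "'a set" and E :: "'a \<Rightarrow> 'a \<Rightarrow> bool"
  assumes fin: "finite V"
    and sym: "E x y \<Longrightarrow> E y x"
    and irrefl: "\<not> E x x"
begin

lemma finite_sub: "T \<subseteq> V \<Longrightarrow> finite T"
  using fin finite_subset by blast

lemma degsum_insert:
  assumes "finite T" "y \<notin> T"
  shows "degsum E (insert y T) = degsum E T + 2 * card (nbs E T y)"
proof -
  have 1: "card (nbs E (insert y T) x) = card (nbs E T x) + (if E x y then 1 else 0)" if "x \<in> T" for x
  proof (cases "E x y")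
    case True
    then have "nbs E (insert y T) x = insert y (nbs E T x)" by auto
    then show ?thesis using True assms by simp
  next
    case False
    then have "nbs E (insert y T) x = nbs E T x" by auto
    then show ?thesis using False by simp
  qed
  have 2: "nbs E (insert y T) y = nbs E T y" using irrefl by auto
  have "(\<Sum>x\<in>T. (if E x y then 1 else 0::nat)) = card {x\<in>T. E x y}"
    using assms by (simp add: sum.If_cases Int_def)
  also have "{x\<in>T. E x y} = nbs E T y" using sym by auto
  finally have 3: "(\<Sum>x\<in>T. (if E x y then 1 else 0::nat)) = card (nbs E T y)" .
  show ?thesis
    unfolding degsum_def using assms 1 2 3 by (simp add: sum.distrib)
qed

lemma degsum_Un:
  assumes "finite C" "finite W" "C \<inter> W = {}" "\<And>x y. x \<in> C \<Longrightarrow> y \<in> W \<Longrightarrow> \<not> E x y"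
  shows "degsum E (C \<union> W) = degsum E C + degsum E W"
proof -
  have "nbs E (C \<union> W) x = nbs E C x" if "x \<in> C" for x using assms(4) that by auto
  moreover have "nbs E (C \<union> W) x = nbs E W x" if "x \<in> W" for x
    using assms(4)[OF _ that] by (intro set_eqI) (simp, metis sym)
  ultimately show ?thesis unfolding degsum_def using assms by (simp add: sum.union_disjoint)
qed

lemma card_nbs_less: "finite T \<Longrightarrow> x \<in> T \<Longrightarrow> card (nbs E T x) < card T"
  by (rule psubset_card_mono) (use irrefl[of x] nbs_subset[of E T x] in auto)

lemma degsum_le: "finite T \<Longrightarrow> degsum E T \<le> card T * (card T - 1)"
  unfolding degsum_def using sum_bounded_above[of T "\<lambda>x. card (nbs E T x)" "card T - 1"] card_nbs_less
  by (metis Suc_pred' add.commute bot_nat_0.not_eq_extremum less_Suc_eq_le not_less_zero of_nat_id plus_1_eq_Suc)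

end

definition gpath :: "('a \<Rightarrow> 'a \<Rightarrow> bool) \<Rightarrow> 'a set \<Rightarrow> 'a list \<Rightarrow> bool" where
  "gpath E W xs \<longleftrightarrow> distinct xs \<and> set xs \<subseteq> W \<and> successively E xs"

lemma gpath_take: "gpath E W xs \<Longrightarrow> gpath E W (take m xs)"
  unfolding gpath_def
  by (metis append_take_drop_id distinct_take set_take_subset subset_trans successively_append_iff)

text \<open>\<open>r\<close> is the vertex cover number of the path: the complete bipartite graph
  with parts of sizes \<open>r\<close> and \<open>r + 1\<close> contains it, since
  \<open>k \<le> 2 * r + 1\<close>.\<close>

locale path_free = fin_graph +
  fixes k r :: nat
  assumes k2: "2 \<le> k" and r_def: "r = k div 2"
    and no_path: "\<And>xs. gpath E V xs \<Longrightarrow> length xs \<noteq> k"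
begin

lemma r_pos: "1 \<le> r" and k_le: "k \<le> 2 * r + 1" and r_le: "2 * r \<le> k"
  using k2 unfolding r_def by auto

lemma path_short: "gpath E V xs \<Longrightarrow> length xs < k"
  using no_path[of "take k xs"] gpath_take[of E V xs k] by (cases "k \<le> length xs") auto

text \<open>A longest path whose two ends have degree sum at least its length closes up to a cycle,
  so by maximality its vertex set has no edge leaving it.\<close>

lemma small_closed_set:
  assumes W: "W \<subseteq> V" "W \<noteq> {}" and deg: "\<And>w. w \<in> W \<Longrightarrow> r \<le> card (nbs E W w)"
  obtains C where "C \<subseteq> W" "C \<noteq> {}" "card C < k" "\<And>x y. x \<in> C \<Longrightarrow> y \<in> W - C \<Longrightarrow> \<not> E x y"
proof -
  have finW: "finite W" using W finite_sub by blast
  have gpV: "gpath E W xs \<Longrightarrow> gpath E V xs" for xs using W unfolding gpath_def by auto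
  obtain w0 where w0: "w0 \<in> W" using W by blast
  have "gpath E W [w0]" using w0 by (simp add: gpath_def)
  then obtain xs where xs: "gpath E W xs" and max: "\<And>ys. gpath E W ys \<Longrightarrow> length ys \<le> length xs"
    using ex_has_greatest_nat[of "gpath E W" "[w0]" length k] path_short gpV
    by (metis less_imp_le_nat)
  define m where "m = length xs"
  have m1: "1 \<le> m" using max[OF \<open>gpath E W [w0]\<close>] by (simp add: m_def)
  have mk: "m < k" using path_short[OF gpV[OF xs]] by (simp add: m_def)
  have ne: "xs \<noteq> []" using m1 m_def by auto
  have dist: "distinct xs" and setxs: "set xs \<subseteq> W" and succ: "successively E xs"
    using xs by (auto simp: gpath_def)
  have h0: "nbs E W (hd xs) \<subseteq> set xs"
  proof
    fix y assume y: "y \<in> nbs E W (hd xs)"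
    show "y \<in> set xs"
    proof (rule ccontr)
      assume "y \<notin> set xs"
      then have "gpath E W (y # xs)"
        using y xs ne sym unfolding gpath_def by (auto simp: successively_Cons)
      from max[OF this] show False by simp
    qed
  qed
  have hl: "nbs E W (last xs) \<subseteq> set xs"
  proof
    fix y assume y: "y \<in> nbs E W (last xs)"
    show "y \<in> set xs"
    proof (rule ccontr)
      assume "y \<notin> set xs"
      then have "gpath E W (xs @ [y])"
        using y xs ne unfolding gpath_def by (auto simp: successively_append_iff)
      from max[OF this] show False by simp
    qed
  qed
  \<comment> \<open>An index in both \<open>I\<close> and \<open>J\<close> closes the path to a
    cycle: follow it up to position \<open>i\<close>, jump to the last vertex, run back to position
    \<open>i + 1\<close> and return to the start.\<close>
  define I where "I = {i. i + 1 < m \<and> E (xs ! 0) (xs ! (i + 1))}"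
  define J where "J = {i. i + 1 < m \<and> E (xs ! i) (xs ! (m - 1))}"
  have finIJ: "finite I" "finite J" by (auto simp: I_def J_def intro: finite_subset[of _ "{..<m}"])
  have "nbs E W (hd xs) \<subseteq> (\<lambda>i. xs ! (i + 1)) ` I"
  proof
    fix y assume y: "y \<in> nbs E W (hd xs)"
    then obtain j where j: "j < m" "y = xs ! j" using h0 m_def by (metis in_set_conv_nth subsetD)
    moreover have "j \<noteq> 0" using y j irrefl[of "hd xs"] ne by (auto simp: hd_conv_nth intro!: gr0I)
    ultimately show "y \<in> (\<lambda>i. xs ! (i + 1)) ` I"
      using y ne by (intro image_eqI[of _ _ "j - 1"]) (auto simp: I_def hd_conv_nth)
  qed
  then have "card (nbs E W (hd xs)) \<le> card I" using finIJ surj_card_le by blast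
  then have cI: "r \<le> card I" using deg[of "hd xs"] setxs ne by (meson hd_in_set le_trans subsetD)
  have "nbs E W (last xs) \<subseteq> (\<lambda>i. xs ! i) ` J"
  proof
    fix y assume y: "y \<in> nbs E W (last xs)"
    then obtain j where j: "j < m" "y = xs ! j" using hl m_def by (metis in_set_conv_nth subsetD)
    moreover have "j \<noteq> m - 1" using y j irrefl ne by (auto simp: last_conv_nth m_def)
    ultimately show "y \<in> (\<lambda>i. xs ! i) ` J"
      using y ne sym by (intro image_eqI[of _ _ "j"]) (auto simp: J_def last_conv_nth m_def)
  qed
  then have "card (nbs E W (last xs)) \<le> card J" using finIJ surj_card_le by blast
  then have cJ: "r \<le> card J" using deg[of "last xs"] setxs ne by (meson last_in_set le_trans subsetD)
  \<comment> \<open>Together \<open>I\<close> and \<open>J\<close> have at least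
    \<open>2 * r \<ge> k - 1 \<ge> m\<close> elements among only \<open>m - 1\<close> possible
    indices, so they meet.\<close>
  have "card (I \<union> J) \<le> m - 1"
    using card_mono[of "{..<m-1}" "I \<union> J"] by (fastforce simp: I_def J_def)
  moreover have "card I + card J = card (I \<union> J) + card (I \<inter> J)"
    using finIJ card_Un_Int by blast
  ultimately have "0 < card (I \<inter> J)" using cI cJ k_le mk m1 by linarith
  then obtain i where i: "i \<in> I" "i \<in> J" by (metis card_gt_0_iff Int_iff ex_in_conv)
  define A where "A = take (i + 1) xs"
  define B where "B = drop (i + 1) xs"
  have im: "i + 1 < m" using i by (auto simp: I_def)
  have AB: "xs = A @ B" by (simp add: A_def B_def)
  have Ane: "A \<noteq> []" and Bne: "B \<noteq> []" using im ne by (auto simp: A_def B_def m_def)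
  have lastA: "last A = xs ! i" using im by (simp add: A_def m_def take_Suc_conv_app_nth)
  have hdB: "hd B = xs ! (i + 1)" using im by (simp add: B_def m_def hd_drop_conv_nth)
  have lastB: "last B = xs ! (m - 1)" using Bne AB ne by (metis last_appendR last_conv_nth m_def)
  have hdA: "hd A = xs ! 0" using ne by (simp add: A_def hd_conv_nth)
  define ys where "ys = A @ rev B"
  have "successively E B" using succ by (simp add: AB successively_append_iff)
  then have "successively (\<lambda>x y. E y x) B"
    by (rule successively_mono) (use sym in auto)
  have sy: "successively E ys"
    using \<open>successively (\<lambda>x y. E y x) B\<close> succ i Ane Bne lastA lastB hdA unfolding ys_def AB J_def
    by (auto simp: successively_append_iff successively_rev hd_rev)
  have cyc: "E (last ys) (hd ys)"
    using i sym Ane Bne hdA hdB unfolding ys_def I_def by (auto simp: last_rev)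
  have ysd: "distinct ys" "set ys = set xs" "length ys = m" using dist unfolding ys_def AB m_def by auto
  have closed: "\<not> E x w" if x: "x \<in> set xs" and w: "w \<in> W - set xs" for x w
  proof
    assume e: "E x w"
    obtain as bs where s: "ys = as @ x # bs" using x ysd split_list by metis
    have "successively E (w # x # bs @ as)"
      using sy cyc sym[OF e] unfolding s
      by (cases "as = []") (auto simp: successively_append_iff successively_Cons split: if_splits)
    moreover have "distinct (w # x # bs @ as)" "set (w # x # bs @ as) \<subseteq> W" "length (w # x # bs @ as) = m + 1"
      using ysd w setxs unfolding s by auto
    ultimately show False using max[of "w # x # bs @ as"] m_def by (auto simp: gpath_def)
  qed
  show ?thesis
    by (rule that[of "set xs"]) (use setxs ne mk dist closed in \<open>auto simp: distinct_card m_def\<close>)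
qed

text \<open>The Erdos-Gallai bound. Deleting a vertex with fewer than \<open>r\<close> neighbours
  costs at most \<open>2 * (r - 1) \<le> k - 2\<close>; if there is none,
  \<open>small_closed_set\<close> splits off a piece with fewer than \<open>k\<close> vertices,
  where the bound is trivial.\<close>

lemma degsum_bound:
  assumes "W \<subseteq> V"
  shows "degsum E W \<le> (k - 2) * card W"
  using assms
proof (induction "card W" arbitrary: W rule: less_induct)
  case less
  have finW: "finite W" using less.prems finite_sub by blast
  show ?case
  proof (cases "W = {}")
    case True
    then show ?thesis by (simp add: degsum_def)
  next
    case False
    show ?thesis
    proof (cases "\<forall>w\<in>W. r \<le> card (nbs E W w)")
      case True
      obtain C where C: "C \<subseteq> W" "C \<noteq> {}" "card C < k" "\<And>x y. x \<in> C \<Longrightarrow> y \<in> W - C \<Longrightarrow> \<not> E x y"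
        using small_closed_set[OF less.prems False] True by metis
      have finC: "finite C" using C finW finite_subset by blast
      have lt: "card (W - C) < card W" using C finW by (intro psubset_card_mono) auto
      have "degsum E W = degsum E C + degsum E (W - C)"
        using degsum_Un[of C "W - C"] C finC finW by (simp add: Un_absorb1)
      also have "degsum E (W - C) \<le> (k - 2) * card (W - C)"
        using less.hyps[OF lt] less.prems by blast
      also have "degsum E C \<le> card C * (card C - 1)" using degsum_le finC by blast
      also have "\<dots> \<le> card C * (k - 2)" using C(3) by (intro mult_le_mono2) auto
      also have "card C * (k - 2) + (k - 2) * card (W - C) = (k - 2) * card W"
        using C finC finW by (simp add: card_Diff_subset card_mono flip: distrib_left add_mult_distrib2)
          (metis add_mult_distrib2 card_mono le_add_diff_inverse mult.commute)
      finally show ?thesis by simp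
    next
      case False
      then obtain w where w: "w \<in> W" "card (nbs E W w) < r" by force
      have W: "W = insert w (W - {w})" using w by blast
      have lt: "card (W - {w}) < card W" by (rule card_Diff1_less[OF finW w(1)])
      have "degsum E W = degsum E (W - {w}) + 2 * card (nbs E (W - {w}) w)"
        using degsum_insert[of "W - {w}" w] finW W by simp
      also have "degsum E (W - {w}) \<le> (k - 2) * card (W - {w})"
        using less.hyps[OF lt] less.prems by blast
      also have "2 * card (nbs E (W - {w}) w) \<le> k - 2"
        using w(2) card_nbs_mono[OF finW, of "W - {w}" E w] r_le by auto
      also have "(k - 2) * card (W - {w}) + (k - 2) = (k - 2) * card W"
        using w finW by (metis card_Suc_Diff1 mult_Suc_right add.commute)
      finally show ?thesis by simp
    qed
  qed
qed

end

section \<open>Vertices of high degree and common neighbourhoods\<close>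

lemma card_nbs_sum: "finite T \<Longrightarrow> card (nbs E T x) = (\<Sum>y\<in>T. if E x y then 1 else 0)"
  by (simp add: nbs_def sum.If_cases Int_def)

context fin_graph begin

lemma sum_card_nbs_swap:
  assumes "finite S" "finite T"
  shows "(\<Sum>x\<in>S. card (nbs E T x)) = (\<Sum>y\<in>T. card (nbs E S y))"
proof -
  have "E x y = E y x" for x y using sym by blast
  then show ?thesis
    unfolding card_nbs_sum[OF assms(1)] card_nbs_sum[OF assms(2)]
    by (subst sum.swap) simp
qed

end

context path_free begin

text \<open>Edges from \<open>M\<close> to its complement contribute twice to the total degree sum;
  this gains a factor of about two over averaging.\<close>

lemma card_high_degree:
  assumes M: "M \<subseteq> V" and d: "\<And>x. x \<in> M \<Longrightarrow> d \<le> card (nbs E V x)"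
  shows "2 * d * card M \<le> (k - 2) * (card V + card M)"
proof -
  have finM: "finite M" using M finite_sub by blast
  define S where "S = (\<Sum>x\<in>M. card (nbs E (V - M) x))"
  have split: "card (nbs E V x) = card (nbs E M x) + card (nbs E (V - M) x)" for x
  proof -
    have "nbs E V x = nbs E M x \<union> nbs E (V - M) x" using M by auto
    moreover have "nbs E M x \<inter> nbs E (V - M) x = {}" by auto
    ultimately show ?thesis using finM fin by (simp add: card_Un_disjoint)
  qed
  have Q: "(\<Sum>x\<in>M. card (nbs E V x)) = degsum E M + S"
    unfolding S_def degsum_def split by (simp add: sum.distrib)
  have "S = (\<Sum>x\<in>V - M. card (nbs E M x))"
    unfolding S_def using sum_card_nbs_swap finM fin by simp
  also have "\<dots> \<le> (\<Sum>x\<in>V - M. card (nbs E V x))"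
    using card_nbs_mono[OF fin M] by (intro sum_mono)
  finally have S: "S \<le> (\<Sum>x\<in>V - M. card (nbs E V x))" .
  have "degsum E V = (\<Sum>x\<in>V - M. card (nbs E V x)) + (\<Sum>x\<in>M. card (nbs E V x))"
    unfolding degsum_def using M fin by (rule sum.subset_diff)
  then have 1: "degsum E M + 2 * S \<le> degsum E V" using Q S by linarith
  have "d * card M \<le> (\<Sum>x\<in>M. card (nbs E V x))"
    using sum_bounded_below[of M d] d by (simp add: mult.commute)
  then have "2 * d * card M \<le> 2 * degsum E M + 2 * S" using Q by simp
  also have "\<dots> \<le> degsum E V + degsum E M" using 1 by simp
  also have "\<dots> \<le> (k - 2) * card V + (k - 2) * card M"
    using degsum_bound[OF order_refl] degsum_bound[OF M] by (rule add_mono)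
  finally show ?thesis by (simp add: add_mult_distrib2)
qed

text \<open>A path alternating between \<open>W\<close> and all of \<open>U\<close>, with both ends
  in \<open>W\<close>, can be built greedily through fresh common neighbours; it has
  \<open>2 * r + 1 \<ge> k\<close> vertices.\<close>

lemma no_alternating_path:
  assumes U: "U \<subseteq> V" "card U = r" and W: "W \<subseteq> V" "U \<inter> W = {}"
    and common: "\<And>u u'. u \<in> U \<Longrightarrow> u' \<in> U \<Longrightarrow> r + 1 \<le> card (nbs E W u \<inter> nbs E W u')"
  shows False
proof -
  have finU: "finite U" and finW: "finite W" using U W finite_sub by auto
  have fresh: "\<exists>w. w \<in> W \<and> E u w \<and> E u' w \<and> w \<notin> S"
    if "u \<in> U" "u' \<in> U" "finite S" "card (S \<inter> W) \<le> r" for u u' S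
  proof (rule ccontr)
    assume "\<not> ?thesis"
    then have "nbs E W u \<inter> nbs E W u' \<subseteq> S \<inter> W" by auto
    then have "card (nbs E W u \<inter> nbs E W u') \<le> card (S \<inter> W)" using that by (intro card_mono) auto
    then show False using common[OF that(1,2)] that(4) by linarith
  qed
  \<comment> \<open>The path uses exactly \<open>length us\<close> vertices of \<open>W\<close>,
    fewer than the \<open>r + 1\<close> common neighbours, so it can always be prolonged in front of
    \<open>hd us\<close>.\<close>
  have step: "\<exists>xs. xs \<noteq> [] \<and> hd xs = hd us \<and> distinct xs \<and> successively E xs \<and> set us \<subseteq> set xs \<and> set xs \<subseteq> set us \<union> W \<and>
      card (set xs \<inter> W) = length us \<and> length xs = 2 * length us"
    if "us \<noteq> []" "distinct us" "set us \<subseteq> U" "length us \<le> r" for us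
    using that
  proof (induction us rule: list_nonempty_induct)
    case (single u)
    obtain w where w: "w \<in> W" "E u w" using fresh[of u u "{}"] single by auto
    then show ?case using W single irrefl
      by (intro exI[of _ "[u, w]"]) (auto simp: Int_insert_left)
  next
    case (cons u us)
    then obtain xs where xs: "xs \<noteq> []" "hd xs = hd us" "distinct xs" "successively E xs" "set us \<subseteq> set xs"
      "set xs \<subseteq> set us \<union> W" "card (set xs \<inter> W) = length us" "length xs = 2 * length us"
      by auto
    obtain w where w: "w \<in> W" "E u w" "E (hd us) w" "w \<notin> set xs"
      using fresh[of u "hd us" "set xs"] cons xs(7) by (auto simp: subset_iff)
    have "u \<notin> W" using cons W by auto
    moreover have "u \<notin> set xs" using xs(6) cons W by auto
    moreover have "u \<noteq> w" using w irrefl by auto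
    moreover have "set (u # w # xs) \<inter> W = insert w (set xs \<inter> W)" using calculation w by auto
    ultimately show ?case using xs w(1,2,4) sym[OF w(3)] cons
      by (intro exI[of _ "u # w # xs"]) (simp_all add: successively_Cons, blast)
  qed
  obtain us where us: "set us = U" "distinct us" using finU finite_distinct_list by blast
  have len: "length us = r" using us U by (metis distinct_card)
  then have ne: "us \<noteq> []" using r_pos by auto
  obtain xs where xs: "xs \<noteq> []" "hd xs = hd us" "distinct xs" "successively E xs"
      "set xs \<subseteq> set us \<union> W" "card (set xs \<inter> W) = length us" "length xs = 2 * length us"
    using step[OF ne us(2)] us len by auto
  have hU: "hd us \<in> U" using ne us by auto
  \<comment> \<open>One more vertex of \<open>W\<close> in front raises the length from
    \<open>2 * r\<close> to \<open>2 * r + 1\<close>.\<close>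
  obtain w where w: "w \<in> W" "E (hd us) w" "w \<notin> set xs"
    using fresh[OF hU hU, of "set xs"] xs len by auto
  have "gpath E V (w # xs)"
    unfolding gpath_def using xs w(1,3) sym[OF w(2)] us U W by (simp add: successively_Cons) blast
  from path_short[OF this] show False using xs len k_le by simp
qed

lemma complete_bipartite_bound:
  assumes "U \<subseteq> V" "W \<subseteq> V" "U \<inter> W = {}" "r \<le> card U" and e: "\<And>u w. u \<in> U \<Longrightarrow> w \<in> W \<Longrightarrow> E u w"
  shows "card W \<le> r"
proof (rule ccontr)
  assume c: "\<not> card W \<le> r"
  obtain U' where U': "U' \<subseteq> U" "card U' = r" using obtain_subset_with_card_n[OF assms(4)] by metis
  have "nbs E W u = W" if "u \<in> U'" for u using e U' that by auto
  then have common: "r + 1 \<le> card (nbs E W u \<inter> nbs E W u')" if "u \<in> U'" "u' \<in> U'" for u u'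
    using that c by simp
  have sub: "U' \<subseteq> V" "U' \<inter> W = {}" using U'(1) assms(1,3) by auto
  show False
    by (rule no_alternating_path[OF sub(1) U'(2) assms(2) sub(2) common])
qed

text \<open>Two such vertices share at least \<open>k\<close> neighbours. Among any \<open>r\<close>
  of them, at most \<open>r - 1\<close> of the shared neighbours lie in the chosen set, which leaves
  \<open>k - (r - 1) \<ge> r + 1\<close> outside it.\<close>

lemma card_very_high_degree:
  "card {u \<in> V. card V + k \<le> 2 * card (nbs E V u)} < r" (is "card ?X < r")
proof (rule ccontr)
  assume "\<not> ?thesis"
  then have "r \<le> card ?X" by simp
  then obtain U where U: "U \<subseteq> ?X" "card U = r" by (rule obtain_subset_with_card_n)
  have finU: "finite U" by (rule finite_subset[OF U(1)]) (use fin in simp)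
  have "r + 1 \<le> card (nbs E (V - U) u \<inter> nbs E (V - U) u')" if u: "u \<in> U" "u' \<in> U" for u u'
  proof -
    let ?N = "nbs E V u" and ?N' = "nbs E V u'"
    have "card (?N \<union> ?N') \<le> card V" using fin by (intro card_mono) auto
    moreover have "card ?N + card ?N' = card (?N \<union> ?N') + card (?N \<inter> ?N')"
      using fin by (intro card_Un_Int) auto
    moreover have "card V + k \<le> 2 * card ?N" "card V + k \<le> 2 * card ?N'" using u U by auto
    ultimately have k: "k \<le> card (?N \<inter> ?N')" by linarith
    have "?N \<inter> ?N' \<subseteq> (nbs E (V - U) u \<inter> nbs E (V - U) u') \<union> (U - {u})" using irrefl by auto
    then have "card (?N \<inter> ?N') \<le> card ((nbs E (V - U) u \<inter> nbs E (V - U) u') \<union> (U - {u}))"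
      using fin finU by (intro card_mono) auto
    also have "\<dots> \<le> card (nbs E (V - U) u \<inter> nbs E (V - U) u') + card (U - {u})" by (rule card_Un_le)
    also have "card (U - {u}) = r - 1" using U u finU by simp
    finally show ?thesis using k r_le r_pos by linarith
  qed
  note common = this
  have sub: "U \<subseteq> V" "U \<inter> (V - U) = {}" using U by auto
  show False
    by (rule no_alternating_path[OF sub(1) U(2) Diff_subset sub(2) common])
qed

text \<open>Removing a closed set does not change the degrees in the rest, so
  \<open>small_closed_set\<close> can be iterated.\<close>

lemma partition_small_closed:
  assumes "W \<subseteq> V" "\<And>w. w \<in> W \<Longrightarrow> r \<le> card (nbs E W w)"
  shows "\<exists>P. partition_on W P \<and> (\<forall>C\<in>P. card C < k \<and> (\<forall>x\<in>C. \<forall>y\<in>W - C. \<not> E x y))"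
  using assms
proof (induction "card W" arbitrary: W rule: less_induct)
  case less
  have finW: "finite W" using less.prems finite_sub by blast
  show ?case
  proof (cases "W = {}")
    case True
    then show ?thesis by (intro exI[of _ "{}"]) (auto simp: partition_on_def)
  next
    case False
    obtain C where C: "C \<subseteq> W" "C \<noteq> {}" "card C < k" "\<And>x y. x \<in> C \<Longrightarrow> y \<in> W - C \<Longrightarrow> \<not> E x y"
      using small_closed_set[OF less.prems(1) False] less.prems(2) by metis
    have lt: "card (W - C) < card W" using C finW by (intro psubset_card_mono) auto
    have "nbs E (W - C) w = nbs E W w" if "w \<in> W - C" for w using that C(4)[of _ w] by (intro set_eqI) (simp, metis sym)
    then have "r \<le> card (nbs E (W - C) w)" if "w \<in> W - C" for w
      using that less.prems(2)[of w] by simp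
    moreover have "W - C \<subseteq> V" using less.prems(1) by blast
    ultimately obtain P where P: "partition_on (W - C) P"
      "\<forall>D\<in>P. card D < k \<and> (\<forall>x\<in>D. \<forall>y\<in>W - C - D. \<not> E x y)"
      using less.hyps[OF lt] by blast
    have "partition_on W (insert C P)"
      using P(1) C(1,2) unfolding partition_on_def by (auto simp: disjoint_def)
    moreover have "\<not> E x y" if "D \<in> P" "x \<in> D" "y \<in> W - D" for D x y
    proof (cases "y \<in> C")
      case True
      have "x \<in> W - C" using P(1) that by (auto simp: partition_on_def)
      then show ?thesis using True C(4) sym by blast
    next
      case False
      then show ?thesis using P(2) that by blast
    qed
    ultimately show ?thesis using C P(2) by (intro exI[of _ "insert C P"]) auto
  qed
qed

end

section \<open>Hall's theorem and extension of partial embeddings\<close>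

text \<open>The Halmos-Vaughan induction. A proper nonempty tight subfamily is matched first and its
  union removed from the other sets; if there is none, any choice for one index preserves Hall's
  condition for the rest.\<close>

lemma hall_marriage:
  assumes "finite I" "\<And>i. i \<in> I \<Longrightarrow> finite (S i)"
    and "\<And>J. J \<subseteq> I \<Longrightarrow> card J \<le> card (\<Union>i\<in>J. S i)"
  shows "\<exists>f. inj_on f I \<and> (\<forall>i\<in>I. f i \<in> S i)"
  using assms
proof (induction "card I" arbitrary: I S rule: less_induct)
  case less
  note finI = less.prems(1) and finS = less.prems(2) and hall = less.prems(3)
  show ?case
  proof (cases "\<exists>J. J \<subseteq> I \<and> J \<noteq> {} \<and> J \<noteq> I \<and> card (\<Union>i\<in>J. S i) \<le> card J")
    case True
    then obtain J where J: "J \<subseteq> I" "J \<noteq> {}" "J \<noteq> I" "card (\<Union>i\<in>J. S i) \<le> card J" by blast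
    have finJ: "finite J" using J finI finite_subset by blast
    have "card J < card I" using J finI by (intro psubset_card_mono) auto
    then obtain f where f: "inj_on f J" "\<forall>i\<in>J. f i \<in> S i"
      using less.hyps[of J S] finJ finS hall J(1) by (metis subset_iff subset_trans)
    let ?U = "\<Union>i\<in>J. S i"
    have finU: "finite ?U" using finJ finS J(1) by blast
    have "card (I - J) < card I" using J finI by (intro psubset_card_mono) auto
    moreover have "card K \<le> card (\<Union>i\<in>K. S i - ?U)" if K: "K \<subseteq> I - J" for K
    proof -
      have finK: "finite K" using K finI finite_subset by blast
      have "card K + card J = card (K \<union> J)" using K finK finJ by (subst card_Un_disjoint) auto
      also have "\<dots> \<le> card (\<Union>i\<in>K \<union> J. S i)" using K J by (intro hall) auto
      also have "(\<Union>i\<in>K \<union> J. S i) = (\<Union>i\<in>K. S i - ?U) \<union> ?U" by auto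
      also have "card \<dots> \<le> card (\<Union>i\<in>K. S i - ?U) + card ?U" by (rule card_Un_le)
      finally show ?thesis using J(4) by linarith
    qed
    ultimately obtain g where g: "inj_on g (I - J)" "\<forall>i\<in>I - J. g i \<in> S i - ?U"
      using less.hyps[of "I - J" "\<lambda>i. S i - ?U"] finI finS by auto
    have "inj_on (\<lambda>i. if i \<in> J then f i else g i) I"
    proof (rule inj_onI)
      fix x y assume xy: "x \<in> I" "y \<in> I" "(if x \<in> J then f x else g x) = (if y \<in> J then f y else g y)"
      show "x = y"
      proof (cases "x \<in> J"; cases "y \<in> J")
        assume "x \<in> J" "y \<in> J" then show ?thesis using xy f(1) by (simp add: inj_on_eq_iff)
      next
        assume a: "x \<in> J" "y \<notin> J"
        then have "f x \<in> ?U" using f(2) by blast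
        moreover have "g y \<notin> ?U" using g(2) a xy(2) by blast
        ultimately show ?thesis using xy(3) a by simp
      next
        assume a: "x \<notin> J" "y \<in> J"
        then have "f y \<in> ?U" using f(2) by blast
        moreover have "g x \<notin> ?U" using g(2) a xy(1) by blast
        ultimately show ?thesis using xy(3) a by simp
      next
        assume "x \<notin> J" "y \<notin> J" then show ?thesis using xy g(1) by (simp add: inj_on_eq_iff)
      qed
    qed
    then show ?thesis using f(2) g(2) by (intro exI[of _ "\<lambda>i. if i \<in> J then f i else g i"]) auto
  next
    case False
    show ?thesis
    proof (cases "I = {}")
      case True
      then show ?thesis by simp
    next
      case I: False
      then obtain i where i: "i \<in> I" by blast
      have "card {i} \<le> card (S i)" using hall[of "{i}"] i by simp
      then obtain x where x: "x \<in> S i" by fastforce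
      have "card (I - {i}) < card I" by (rule card_Diff1_less[OF finI i])
      moreover have "card K \<le> card (\<Union>j\<in>K. S j - {x})" if K: "K \<subseteq> I - {i}" for K
      proof (cases "K = {}")
        case True
        then show ?thesis by simp
      next
        case Kne: False
        then have "card K < card (\<Union>j\<in>K. S j)" using False K i by (metis Diff_iff insertI1 not_le subset_Diff_insert subset_iff)
        moreover have "(\<Union>j\<in>K. S j - {x}) = (\<Union>j\<in>K. S j) - {x}" by auto
        moreover have "finite (\<Union>j\<in>K. S j)" using K finI finS finite_subset[of K I] by blast
        ultimately show ?thesis by (cases "x \<in> (\<Union>j\<in>K. S j)") (auto simp: card_Diff_singleton_if)
      qed
      ultimately obtain g where g: "inj_on g (I - {i})" "\<forall>j\<in>I - {i}. g j \<in> S j - {x}"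
        using less.hyps[of "I - {i}" "\<lambda>j. S j - {x}"] finI finS by auto
      have "inj_on (g(i := x)) (insert i (I - {i}))"
        using g by (subst inj_on_insert) (auto simp: inj_on_def)
      moreover have "insert i (I - {i}) = I" using i by blast
      ultimately show ?thesis using g(2) x by (intro exI[of _ "g(i := x)"]) auto
    qed
  qed
qed

text \<open>Greedy choice: each chosen element discards itself and at most \<open>c\<close> elements
  in conflict with it.\<close>

lemma conflict_free_subset:
  assumes "finite T" "\<And>x. x \<in> T \<Longrightarrow> card {y \<in> T. R x y} \<le> c" "\<And>x y. R x y \<Longrightarrow> R y x"
  shows "\<exists>I\<subseteq>T. (\<forall>x\<in>I. \<forall>y\<in>I. x \<noteq> y \<longrightarrow> \<not> R x y) \<and> card T \<le> (c + 1) * card I"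
  using assms(1,2)
proof (induction "card T" arbitrary: T rule: less_induct)
  case less
  show ?case
  proof (cases "T = {}")
    case True
    then show ?thesis by auto
  next
    case False
    then obtain x where x: "x \<in> T" by blast
    let ?N = "insert x {y \<in> T. R x y}"
    have lt: "card (T - ?N) < card T" using x less.prems(1) by (intro psubset_card_mono) auto
    have "card {z \<in> T - ?N. R y z} \<le> c" if "y \<in> T - ?N" for y
    proof -
      have "card {z \<in> T - ?N. R y z} \<le> card {z \<in> T. R y z}"
        using less.prems(1) by (intro card_mono) auto
      also have "\<dots> \<le> c" using less.prems(2) that by blast
      finally show ?thesis .
    qed
    then obtain I where I: "I \<subseteq> T - ?N" "\<forall>y\<in>I. \<forall>z\<in>I. y \<noteq> z \<longrightarrow> \<not> R y z" "card (T - ?N) \<le> (c + 1) * card I"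
      using less.hyps[OF lt] less.prems(1) by blast
    have finI: "finite I" using I(1) less.prems(1) finite_subset by blast
    have "card ?N \<le> c + 1"
      using card_insert_le_m1[of "c + 1" "{y \<in> T. R x y}" x] less.prems(2)[OF x] by simp
    moreover have "card T \<le> card ?N + card (T - ?N)"
      using card_Un_le[of ?N "T - ?N"] x less.prems(1) by (simp add: Un_absorb1 subset_iff insert_absorb)
    ultimately have "card T \<le> (c + 1) * (card I + 1)" using I(3) by (simp add: algebra_simps)
    moreover have "card (insert x I) = card I + 1" using I(1) finI by (subst card_insert_disjoint) auto
    moreover have "\<forall>y\<in>insert x I. \<forall>z\<in>insert x I. y \<noteq> z \<longrightarrow> \<not> R y z"
      using I(1,2) assms(3) by blast
    ultimately show ?thesis using I(1) x by (intro exI[of _ "insert x I"]) auto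
  qed
qed

text \<open>In the applications \<open>E\<close> is the adjacency of the complement of the host, so
  edges of the guest have to avoid \<open>E\<close>.\<close>

definition emb :: "('a \<Rightarrow> 'a \<Rightarrow> bool) \<Rightarrow> ('b \<Rightarrow> 'b \<Rightarrow> bool) \<Rightarrow> 'b set \<Rightarrow> ('a \<Rightarrow> 'b) \<Rightarrow> 'a set \<Rightarrow> bool" where
  "emb A E V f S \<longleftrightarrow> inj_on f S \<and> f ` S \<subseteq> V \<and> (\<forall>x\<in>S. \<forall>y\<in>S. A x y \<longrightarrow> \<not> E (f x) (f y))"

lemma emb_insert:
  assumes f: "emb A E V f S" and x: "x \<notin> S" and w: "w \<in> V" "w \<notin> f ` S"
    and nb: "\<And>y. y \<in> S \<Longrightarrow> A x y \<Longrightarrow> \<not> E (f y) w"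
    and symA: "\<And>x y. A x y \<Longrightarrow> A y x" and irrA: "\<And>x. \<not> A x x" and symE: "\<And>x y. E x y \<Longrightarrow> E y x"
  shows "emb A E V (f(x := w)) (insert x S)"
proof -
  have "inj_on (f(x := w)) (insert x S)"
    using f x w unfolding emb_def by (subst inj_on_insert) (auto simp: inj_on_def)
  moreover have "f(x := w) ` insert x S \<subseteq> V" using f x w unfolding emb_def by auto
  moreover have "\<not> E ((f(x := w)) y) ((f(x := w)) z)" if "y \<in> insert x S" "z \<in> insert x S" "A y z" for y z
  proof (cases "y = x"; cases "z = x")
    assume "y = x" "z = x" then show ?thesis using that irrA by blast
  next
    assume "y = x" "z \<noteq> x" then show ?thesis using that nb[of z] symE by auto
  next
    assume "y \<noteq> x" "z = x" then show ?thesis using that nb[of y] symA by auto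
  next
    assume "y \<noteq> x" "z \<noteq> x" then show ?thesis using that f unfolding emb_def by auto
  qed
  ultimately show ?thesis unfolding emb_def by blast
qed

text \<open>\<open>cond\<close> orders \<open>T\<close> backwards: the vertex \<open>x\<close> it
  supplies for \<open>T'\<close> is placed after the rest of \<open>T'\<close>. At that moment the
  images already used, the vertices blocked by \<open>Q\<close>, and at most \<open>d\<close>
  vertices for each neighbour in \<open>T'\<close> are forbidden.\<close>

lemma emb_greedy:
  assumes symA: "\<And>x y. A x y \<Longrightarrow> A y x" and irrA: "\<And>x. \<not> A x x" and symE: "\<And>x y. E x y \<Longrightarrow> E y x"
    and f: "emb A E V f Q" and T: "finite T" "Q \<inter> T = {}"
    and L: "finite L" "L \<subseteq> V" "L \<inter> f ` Q = {}" and d: "\<And>w. w \<in> L \<Longrightarrow> card (nbs E L w) \<le> d"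
    and cond: "\<And>T'. T' \<subseteq> T \<Longrightarrow> T' \<noteq> {} \<Longrightarrow>
      \<exists>x\<in>T'. card T' + card {w \<in> L. \<exists>q\<in>Q. A x q \<and> E (f q) w} + card (nbs A T' x) * d \<le> card L"
  shows "\<exists>g. emb A E V g (Q \<union> T) \<and> (\<forall>q\<in>Q. g q = f q) \<and> g ` T \<subseteq> L"
  using T cond
proof (induction "card T" arbitrary: T rule: less_induct)
  case less
  note finT = less.prems(1)
  show ?case
  proof (cases "T = {}")
    case True
    then show ?thesis using f by (intro exI[of _ f]) auto
  next
    case False
    then obtain x where x: "x \<in> T"
      "card T + card {w \<in> L. \<exists>q\<in>Q. A x q \<and> E (f q) w} + card (nbs A T x) * d \<le> card L"
      using less.prems(3)[OF order_refl] by blast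
    have "\<exists>g. emb A E V g (Q \<union> (T - {x})) \<and> (\<forall>q\<in>Q. g q = f q) \<and> g ` (T - {x}) \<subseteq> L"
    proof (rule less.hyps)
      show "card (T - {x}) < card T" by (rule card_Diff1_less[OF finT x(1)])
      show "finite (T - {x})" using finT by simp
      show "Q \<inter> (T - {x}) = {}" using less.prems(2) by blast
      show "\<exists>x\<in>T'. card T' + card {w \<in> L. \<exists>q\<in>Q. A x q \<and> E (f q) w} + card (nbs A T' x) * d \<le> card L"
        if "T' \<subseteq> T - {x}" "T' \<noteq> {}" for T'
        by (rule less.prems(3)) (use that in auto)
    qed
    then obtain g where g: "emb A E V g (Q \<union> (T - {x}))" "\<forall>q\<in>Q. g q = f q" "g ` (T - {x}) \<subseteq> L"
      by blast
    let ?F = "{w \<in> L. \<exists>q\<in>Q. A x q \<and> E (f q) w}"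
    let ?D = "\<Union>y\<in>nbs A (T - {x}) x. nbs E L (g y)"
    have "card ?D \<le> (\<Sum>y\<in>nbs A (T - {x}) x. card (nbs E L (g y)))"
      using finT by (intro card_UN_le) auto
    also have "\<dots> \<le> card (nbs A (T - {x}) x) * d"
      using sum_bounded_above[of "nbs A (T - {x}) x" "\<lambda>y. card (nbs E L (g y))" d] d g(3) by auto
    also have "\<dots> \<le> card (nbs A T x) * d"
      using finT by (intro mult_le_mono1 card_mono) auto
    finally have D: "card ?D \<le> card (nbs A T x) * d" .
    have I: "card (g ` (T - {x})) \<le> card T - 1"
      using card_image_le[of "T - {x}" g] finT x(1) by simp
    \<comment> \<open>\<open>x\<close> is counted in \<open>card T\<close> but not yet placed, which
      makes the bound below strict.\<close>
    have "0 < card T" using finT x(1) card_gt_0_iff by blast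
    have "card (g ` (T - {x}) \<union> ?F \<union> ?D) \<le> card (g ` (T - {x})) + card ?F + card ?D"
      by (meson add_le_mono card_Un_le le_trans order_refl)
    then have "card (g ` (T - {x}) \<union> ?F \<union> ?D) < card L" using D I x(2) \<open>0 < card T\<close> by linarith
    then have "\<not> L \<subseteq> g ` (T - {x}) \<union> ?F \<union> ?D"
      using card_mono[of "g ` (T - {x}) \<union> ?F \<union> ?D" L] finT L(1) by fastforce
    then obtain w where w: "w \<in> L" "w \<notin> g ` (T - {x})" "w \<notin> ?F" "w \<notin> ?D" by blast
    have "w \<notin> g ` (Q \<union> (T - {x}))" using w L(3) g(2) by auto
    moreover have "\<not> E (g y) w" if "y \<in> Q \<union> (T - {x})" "A x y" for y
      using w that g(2) by auto
    moreover have "x \<notin> Q \<union> (T - {x})" using x(1) less.prems(2) by blast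
    ultimately have "emb A E V (g(x := w)) (insert x (Q \<union> (T - {x})))"
      using emb_insert[OF g(1)] w(1) L(2) symA irrA symE by blast
    moreover have "insert x (Q \<union> (T - {x})) = Q \<union> T" using x by blast
    moreover have "x \<notin> Q" using x less.prems(2) by blast
    ultimately show ?thesis using g(2,3) w(1) by (intro exI[of _ "g(x := w)"]) auto
  qed
qed

text \<open>As \<open>Z\<close> is independent, its vertices compete only for distinct images, so a
  system of distinct representatives of their candidate sets is enough.\<close>

lemma emb_hall:
  assumes symA: "\<And>x y. A x y \<Longrightarrow> A y x" and symE: "\<And>x y. E x y \<Longrightarrow> E y x"
    and f: "emb A E V f S" and Z: "finite Z" "S \<inter> Z = {}" "\<And>x y. x \<in> Z \<Longrightarrow> y \<in> Z \<Longrightarrow> \<not> A x y"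
    and U: "finite U" "U \<subseteq> V" "U \<inter> f ` S = {}"
    and hall: "\<And>J. J \<subseteq> Z \<Longrightarrow> J \<noteq> {} \<Longrightarrow> card J \<le> card {u \<in> U. \<exists>z\<in>J. \<forall>y\<in>S. A z y \<longrightarrow> \<not> E (f y) u}"
  shows "\<exists>g. emb A E V g (S \<union> Z) \<and> (\<forall>s\<in>S. g s = f s) \<and> g ` Z \<subseteq> U"
proof -
  define al where "al z = {u \<in> U. \<forall>y\<in>S. A z y \<longrightarrow> \<not> E (f y) u}" for z
  have "card J \<le> card (\<Union>z\<in>J. al z)" if "J \<subseteq> Z" for J
  proof (cases "J = {}")
    case False
    have "{u \<in> U. \<exists>z\<in>J. \<forall>y\<in>S. A z y \<longrightarrow> \<not> E (f y) u} = (\<Union>z\<in>J. al z)" unfolding al_def by auto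
    then show ?thesis using hall[OF that False] by simp
  qed simp
  moreover have "finite (al z)" for z using U(1) unfolding al_def by simp
  ultimately obtain h where h: "inj_on h Z" "\<forall>z\<in>Z. h z \<in> al z" using hall_marriage[of Z al] Z(1) by blast
  define g where "g x = (if x \<in> Z then h x else f x)" for x
  have gS: "g x = f x" if "x \<in> S" for x using that Z(2) unfolding g_def by auto
  have gZ: "g x = h x" if "x \<in> Z" for x using that unfolding g_def by auto
  have hU: "h z \<in> U" "\<And>y. y \<in> S \<Longrightarrow> A z y \<Longrightarrow> \<not> E (f y) (h z)" if "z \<in> Z" for z
    using h(2) that unfolding al_def by auto
  have "inj_on g S" using f gS unfolding emb_def inj_on_def by simp
  moreover have "inj_on g Z" using h(1) gZ unfolding inj_on_def by simp
  moreover have "g s \<noteq> g z" if "s \<in> S" "z \<in> Z" for s z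
    using gS[OF that(1)] gZ[OF that(2)] hU(1)[OF that(2)] U(3) that(1)
    by (metis disjoint_iff imageI)
  ultimately have "inj_on g (S \<union> Z)" unfolding inj_on_Un using Z(2) by blast
  moreover have "g ` (S \<union> Z) \<subseteq> V" using f gS gZ hU(1) U(2) unfolding emb_def by auto
  moreover have "\<not> E (g x) (g y)" if xy: "x \<in> S \<union> Z" "y \<in> S \<union> Z" "A x y" for x y
  proof (cases "x \<in> Z"; cases "y \<in> Z")
    assume "x \<in> Z" "y \<in> Z" then show ?thesis using Z(3) xy by blast
  next
    assume a: "x \<in> Z" "y \<notin> Z"
    then have "\<not> E (f y) (h x)" using hU(2)[of x y] xy by blast
    then show ?thesis using a symE[of "h x" "f y"] unfolding g_def by auto
  next
    assume a: "x \<notin> Z" "y \<in> Z"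
    then have "\<not> E (f x) (h y)" using hU(2)[of y x] xy symA[of x y] by blast
    then show ?thesis using a unfolding g_def by auto
  next
    assume "x \<notin> Z" "y \<notin> Z" then show ?thesis using xy f unfolding g_def emb_def by auto
  qed
  ultimately have "emb A E V g (S \<union> Z)" unfolding emb_def by blast
  then show ?thesis using gS gZ hU(1) by (intro exI[of _ g]) auto
qed

section \<open>Connected graphs with few edges\<close>

text \<open>\<open>l\<close> is the number of edges minus the number of vertices; it is an integer
  because trees have \<open>l = -1\<close>. Connectivity is stated through cuts, the form in which
  it is applied.\<close>

locale sparse_graph = fin_graph V E for V :: "'a set" and E +
  fixes l :: int
  assumes conn: "\<And>T. T \<subseteq> V \<Longrightarrow> T \<noteq> {} \<Longrightarrow> T \<noteq> V \<Longrightarrow> \<exists>x\<in>T. \<exists>y\<in>V - T. E x y"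
    and degsum_V: "int (degsum E V) = 2 * (int (card V) + l)"
begin

text \<open>Growing \<open>T\<close> to \<open>V\<close> by one vertex across a crossing edge never
  decreases the number of edges minus the number of vertices, and this ends at
  \<open>l\<close>.\<close>

lemma degsum_subset:
  assumes "T \<subseteq> V" "T \<noteq> {}"
  shows "int (degsum E T) \<le> 2 * (int (card T) + l)"
  using assms
proof (induction "card (V - T)" arbitrary: T rule: less_induct)
  case less
  have finT: "finite T" using less.prems finite_sub by blast
  show ?case
  proof (cases "T = V")
    case True
    then show ?thesis using degsum_V by simp
  next
    case False
    then obtain x y where xy: "x \<in> T" "y \<in> V - T" "E x y" using conn less.prems by metis
    have "card (V - insert y T) < card (V - T)"
      using xy fin by (intro psubset_card_mono) auto
    then have "int (degsum E (insert y T)) \<le> 2 * (int (card (insert y T)) + l)"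
      using less.hyps[of "insert y T"] xy less.prems by auto
    moreover have "degsum E (insert y T) = degsum E T + 2 * card (nbs E T y)"
      using degsum_insert finT xy by blast
    moreover have "x \<in> nbs E T y" using xy sym by simp
    then have "0 < card (nbs E T y)" using finT by (auto simp: card_gt_0_iff)
    moreover have "card (insert y T) = card T + 1" using xy finT by simp
    ultimately show ?thesis by simp
  qed
qed

text \<open>Take a vertex of least degree \<open>d\<close> in \<open>T\<close>. If
  \<open>d \<ge> 3\<close>, then \<open>card T * d \<le> 2 * (card T + l)\<close> gives
  \<open>card T \<le> 2 * l\<close>, and \<open>d < card T\<close> then gives
  \<open>d * d \<le> 6 * l\<close>. This supplies the ordering for
  \<open>emb_greedy\<close>.\<close>

lemma elimination:
  assumes T: "T \<subseteq> V" "T \<noteq> {}"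
  shows "\<exists>x\<in>T. card (nbs E T x) \<le> 2 \<or>
    (int (card T) \<le> 2 * l \<and> int (card (nbs E T x)) * int (card (nbs E T x)) \<le> 6 * l)"
proof -
  have finT: "finite T" using T finite_sub by blast
  obtain x where x: "x \<in> T" and min: "\<And>y. y \<in> T \<Longrightarrow> card (nbs E T x) \<le> card (nbs E T y)"
    using ex_min_if_finite[of "(\<lambda>x. card (nbs E T x)) ` T"] finT T(2)
    by (metis (no_types, lifting) arg_min_if_finite(1) arg_min_least)
  define d where "d = int (card (nbs E T x))"
  show ?thesis
  proof (cases "d \<le> 2")
    case True
    then show ?thesis using x unfolding d_def by auto
  next
    case False
    have "card T * card (nbs E T x) \<le> degsum E T"
      unfolding degsum_def using sum_bounded_below[of T "card (nbs E T x)"] min by simp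
    then have 1: "int (card T) * d \<le> 2 * (int (card T) + l)"
      using degsum_subset[OF T] unfolding d_def by (metis of_nat_le_iff of_nat_mult order_trans)
    have "int (card T) * 3 \<le> int (card T) * d" using False by (intro mult_left_mono) auto
    from order_trans[OF this 1] have 2: "int (card T) \<le> 2 * l" by simp
    have "d \<le> int (card T)" using card_nbs_less[OF finT x] unfolding d_def by simp
    then have "d * d \<le> int (card T) * d" using False by (intro mult_right_mono) auto
    from order_trans[OF this 1] have "d * d \<le> 6 * l" using 2 by simp
    then show ?thesis using 2 x unfolding d_def by blast
  qed
qed

section \<open>Counting leaves, path-like vertices and vertices of degree at least three\<close>

definition dg :: "'a \<Rightarrow> nat" where "dg x = card (nbs E V x)"
definition leaves :: "'a set" where "leaves = {x \<in> V. dg x = 1}"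
definition big :: "'a set" where "big = {x \<in> V. 3 \<le> dg x}"

lemma finite_leaves: "finite leaves" and finite_big: "finite big"
  using fin unfolding leaves_def big_def by auto

lemma dg_pos: "2 \<le> card V \<Longrightarrow> x \<in> V \<Longrightarrow> 1 \<le> dg x"
proof -
  assume a: "2 \<le> card V" "x \<in> V"
  then have "V \<noteq> {x}" by auto
  then obtain y where "y \<in> V" "E x y" using conn[of "{x}"] a by auto
  then have "nbs E V x \<noteq> {}" by auto
  then show ?thesis unfolding dg_def using fin by (simp add: Suc_le_eq card_gt_0_iff)
qed

text \<open>The sum of degree minus two over all vertices is \<open>2 * l\<close>; leaves contribute
  -1 each and vertices of degree two nothing.\<close>

lemma sum_excess_big:
  assumes "2 \<le> card V"
  shows "(\<Sum>x\<in>big. int (dg x) - 2) = int (card leaves) + 2 * l"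
proof -
  have V: "V = leaves \<union> (big \<union> {x \<in> V. dg x = 2})" (is "_ = _ \<union> (_ \<union> ?T)")
    using dg_pos[OF assms] unfolding leaves_def big_def by force
  have "(\<Sum>x\<in>V. int (dg x) - 2) = int (degsum E V) - 2 * int (card V)"
    unfolding degsum_def dg_def by (simp add: sum_subtractf)
  also have "\<dots> = 2 * l" using degsum_V by simp
  finally have 1: "(\<Sum>x\<in>V. int (dg x) - 2) = 2 * l" .
  have "(\<Sum>x\<in>V. int (dg x) - 2) = (\<Sum>x\<in>leaves. int (dg x) - 2) + (\<Sum>x\<in>big \<union> ?T. int (dg x) - 2)"
    using fin finite_leaves finite_big
    by (subst V, subst sum.union_disjoint) (auto simp: leaves_def big_def)
  also have "(\<Sum>x\<in>big \<union> ?T. int (dg x) - 2) = (\<Sum>x\<in>big. int (dg x) - 2) + (\<Sum>x\<in>?T. int (dg x) - 2)"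
    using fin finite_big by (subst sum.union_disjoint) (auto simp: big_def)
  also have "(\<Sum>x\<in>?T. int (dg x) - 2) = 0" by (intro sum.neutral) auto
  also have "(\<Sum>x\<in>leaves. int (dg x) - 2) = - int (card leaves)" by (simp add: leaves_def)
  finally show ?thesis using 1 by linarith
qed

lemma card_big:
  assumes "2 \<le> card V"
  shows "int (card big) \<le> int (card leaves) + 2 * l"
proof -
  have "int (card big) = (\<Sum>x\<in>big. 1)" by simp
  also have "\<dots> \<le> (\<Sum>x\<in>big. int (dg x) - 2)" by (intro sum_mono) (auto simp: big_def)
  finally show ?thesis using sum_excess_big[OF assms] by simp
qed

lemma not_two_eq: "2 \<le> card V \<Longrightarrow> {x \<in> V. dg x \<noteq> 2} = leaves \<union> big"
  using dg_pos unfolding leaves_def big_def by force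

lemma leaves_big_disjoint: "leaves \<inter> big = {}" unfolding leaves_def big_def by auto

lemma card_not_two:
  assumes "2 \<le> card V"
  shows "int (card {x \<in> V. dg x \<noteq> 2}) \<le> 2 * int (card leaves) + 2 * l"
  using card_big[OF assms] not_two_eq[OF assms] finite_leaves finite_big leaves_big_disjoint
  by (simp add: card_Un_disjoint)

text \<open>Only vertices in \<open>big\<close> exceed degree two, and their total excess is
  known.\<close>

lemma sum_dg_bound:
  assumes "2 \<le> card V" "W \<subseteq> V"
  shows "int (\<Sum>x\<in>W. dg x) \<le> 2 * int (card W) + int (card leaves) + 2 * l"
proof -
  have finW: "finite W" using assms finite_sub by blast
  have "(\<Sum>x\<in>W. int (dg x) - 2) \<le> (\<Sum>x\<in>W \<inter> big. int (dg x) - 2)"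
  proof -
    have "(\<Sum>x\<in>W. int (dg x) - 2) = (\<Sum>x\<in>W - big. int (dg x) - 2) + (\<Sum>x\<in>W \<inter> big. int (dg x) - 2)"
      using finW by (subst sum.Int_Diff[of W _ big]) (auto simp: add.commute)
    moreover have "(\<Sum>x\<in>W - big. int (dg x) - 2) \<le> 0"
      using assms(2) by (intro sum_nonpos) (auto simp: big_def)
    ultimately show ?thesis by simp
  qed
  also have "\<dots> \<le> (\<Sum>x\<in>big. int (dg x) - 2)"
    using finite_big by (intro sum_mono2) (auto simp: big_def)
  finally show ?thesis using sum_excess_big[OF assms(1)] by (simp add: sum_subtractf)
qed

text \<open>Radius two is required so that, once such vertices are placed, their neighbours and
  everything adjacent to those neighbours still have degree two.\<close>

definition path_like :: "'a set" where
  "path_like = {x \<in> V. dg x = 2 \<and> (\<forall>y\<in>nbs E V x. dg y = 2 \<and> (\<forall>z\<in>nbs E V y. dg z = 2))}"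

text \<open>A vertex is lost if it lies in the set \<open>N\<close> of degrees other than two, next
  to it (\<open>M\<close>), or at distance two through a vertex of degree two (\<open>K\<close>).
  Such an intermediate vertex has only one neighbour outside \<open>N\<close>, so \<open>K\<close>
  is no larger than \<open>M\<close>, and \<open>M\<close> is bounded by the degree sum of
  \<open>N\<close>.\<close>

lemma card_path_like:
  assumes "2 \<le> card V"
  shows "int (card V) \<le> int (card path_like) + 10 * int (card leaves) + 14 * l"
proof -
  define N where "N = {x \<in> V. dg x \<noteq> 2}"
  define M where "M = (\<Union>x\<in>N. nbs E V x)"
  define K where "K = (\<Union>y\<in>M - N. nbs E V y - N)"
  have finN: "finite N" unfolding N_def using fin by simp
  have finM: "finite M" unfolding M_def using fin finN by simp
  have finK: "finite K" unfolding K_def using fin finM by simp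
  have "V \<subseteq> path_like \<union> (N \<union> (M \<union> K))"
  proof
    fix x assume x: "x \<in> V"
    show "x \<in> path_like \<union> (N \<union> (M \<union> K))"
    proof (rule ccontr)
      assume n: "\<not> ?thesis"
      then have x2: "dg x = 2" "x \<notin> N" using x unfolding N_def by auto
      have "\<exists>y. y \<in> V \<and> E x y \<and> (dg y \<noteq> 2 \<or> (\<exists>z\<in>V. E y z \<and> dg z \<noteq> 2))"
      proof (rule ccontr)
        assume "\<not> ?thesis"
        then have "x \<in> path_like" using x x2 unfolding path_like_def by auto
        then show False using n by simp
      qed
      then obtain y where y: "y \<in> V" "E x y" "dg y \<noteq> 2 \<or> (\<exists>z\<in>V. E y z \<and> dg z \<noteq> 2)"
        by blast
      show False
      proof (cases "dg y = 2")
        case False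
        then have "x \<in> M" using y x sym unfolding M_def N_def by auto
        then show False using n by simp
      next
        case True
        then obtain z where "z \<in> V" "E y z" "dg z \<noteq> 2" using y by blast
        then have "y \<in> M - N" using y(1) True sym unfolding M_def N_def by auto
        then have "x \<in> K" using y x x2 sym unfolding K_def by auto
        then show False using n by simp
      qed
    qed
  qed
  moreover have "finite path_like" unfolding path_like_def using fin by simp
  ultimately have "card V \<le> card (path_like \<union> (N \<union> (M \<union> K)))"
    using finN finM finK by (intro card_mono) auto
  also have "\<dots> \<le> card path_like + (card N + (card M + card K))"
    by (meson add_le_mono card_Un_le le_trans order_refl)
  finally have 1: "card V \<le> card path_like + card N + card M + card K" by simp
  have "card M \<le> (\<Sum>x\<in>N. card (nbs E V x))" unfolding M_def using finN by (rule card_UN_le)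
  then have M: "card M \<le> (\<Sum>x\<in>N. dg x)" by (simp add: dg_def)
  have "card K \<le> (\<Sum>y\<in>M - N. card (nbs E V y - N))" unfolding K_def using finM by (intro card_UN_le) auto
  also have "\<dots> \<le> (\<Sum>y\<in>M - N. 1)"
  proof (rule sum_mono)
    fix y assume y: "y \<in> M - N"
    then obtain x where x: "x \<in> N" "E x y" "y \<in> V" unfolding M_def by auto
    have "x \<in> nbs E V y" using x sym unfolding N_def by auto
    then have "card (nbs E V y - {x}) = 1" using y x fin unfolding N_def dg_def by simp
    moreover have "card (nbs E V y - N) \<le> card (nbs E V y - {x})" using x fin by (intro card_mono) auto
    ultimately show "card (nbs E V y - N) \<le> 1" by simp
  qed
  also have "\<dots> \<le> card M" using finM by (simp add: card_mono)
  finally have K: "card K \<le> (\<Sum>x\<in>N. dg x)" using M by simp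
  have "(\<Sum>x\<in>N. int (dg x)) = (\<Sum>x\<in>leaves. int (dg x)) + (\<Sum>x\<in>big. int (dg x))"
    unfolding N_def not_two_eq[OF assms]
    using finite_leaves finite_big leaves_big_disjoint by (rule sum.union_disjoint)
  also have "(\<Sum>x\<in>leaves. int (dg x)) = int (card leaves)" by (simp add: leaves_def)
  also have "(\<Sum>x\<in>big. int (dg x)) = int (card leaves) + 2 * l + 2 * int (card big)"
    using sum_excess_big[OF assms] by (simp add: sum_subtractf)
  finally have "int (\<Sum>x\<in>N. dg x) \<le> 4 * int (card leaves) + 6 * l" using card_big[OF assms] by simp
  then show ?thesis using 1 M K card_not_two[OF assms] unfolding N_def by linarith
qed

lemma leaf_neighbour:
  assumes "x \<in> leaves"
  obtains y where "nbs E V x = {y}" "y \<in> V" "E x y"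
proof -
  have "card (nbs E V x) = 1" using assms unfolding leaves_def dg_def by simp
  then obtain y where y: "nbs E V x = {y}" by (auto simp: card_1_singleton_iff)
  then have "y \<in> nbs E V x" by simp
  then have "y \<in> V" "E x y" by simp_all
  then show ?thesis using y that by blast
qed

text \<open>Two adjacent leaves would form a component of their own.\<close>

lemma leaves_not_adjacent:
  assumes n: "3 \<le> card V" and xy: "x \<in> leaves" "y \<in> leaves"
  shows "\<not> E x y"
proof
  assume e: "E x y"
  have V: "x \<in> V" "y \<in> V" using xy unfolding leaves_def by auto
  have "card {x, y} \<le> 2" by (simp add: card_insert_if)
  then have "{x, y} \<noteq> V" using n by auto
  then obtain u w where uw: "u \<in> {x, y}" "w \<in> V - {x, y}" "E u w" using conn[of "{x, y}"] V by auto
  obtain x' where x': "nbs E V x = {x'}" by (rule leaf_neighbour[OF xy(1)])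
  obtain y' where y': "nbs E V y = {y'}" by (rule leaf_neighbour[OF xy(2)])
  have "y \<in> nbs E V x" using e V by simp
  moreover have "x \<in> nbs E V y" using sym[OF e] V by simp
  ultimately have "nbs E V x = {y}" "nbs E V y = {x}" using x' y' by auto
  moreover have "w \<in> nbs E V u" using uw by simp
  ultimately show False using uw by auto
qed

end

section \<open>Numerical estimates\<close>

text \<open>Here \<open>K\<close> is \<open>k\<close>, the guest has \<open>n\<close> vertices, \<open>n + l\<close> edges and \<open>la\<close> leaves, and the host has \<open>N\<close>
  vertices, of which \<open>H\<close> have complement degree exceeding \<open>d\<close>.\<close>

context
  fixes K n N H d la l :: int
  assumes K: "2 \<le> K" and n: "20 * (K * K) \<le> n" and l: "54 * (K * K) * l \<le> n"
    and N: "n \<le> N" "N \<le> n + K" and H: "(4 * K - 3) * H \<le> (K - 2) * N"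
    and d: "0 \<le> d" "2 * d \<le> 5 * K - 6"
begin

lemma KK: "4 \<le> K * K" "2 * K \<le> K * K"
  using mult_mono[of 2 K 2 K] mult_right_mono[of 2 K K] K by auto

text \<open>For \<open>l \<ge> 1\<close> the edge bound itself forces \<open>n\<close> to be large;
  for \<open>l \<le> 0\<close> the terms in \<open>l\<close> only help.\<close>

lemma l_cases: "l \<le> 0 \<or> (1 \<le> l \<and> 54 * (K * K) \<le> n \<and> 216 * l \<le> n)"
proof (cases "l \<le> 0")
  case False
  then have "54 * (K * K) * 1 \<le> 54 * (K * K) * l" using KK by (intro mult_left_mono) auto
  moreover have "216 * l \<le> 54 * (K * K) * l" using KK False by (intro mult_right_mono) auto
  ultimately show ?thesis using l False by linarith
qed simp

lemma N_pos: "0 \<le> N" using KK n N by linarith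

lemma H_quarter: "4 * H \<le> N"
proof -
  have "(4 * K - 3) * (4 * H) \<le> 4 * ((K - 2) * N)" using H by (simp add: algebra_simps)
  also have "\<dots> = (4 * K - 8) * N" by (simp add: algebra_simps)
  also have "\<dots> \<le> (4 * K - 3) * N" using N_pos by (intro mult_right_mono) auto
  finally show ?thesis using K by (simp add: mult_le_cancel_left)
qed

text \<open>Room for the main greedy round: about a third of the guest is kept aside, and this has
  to outweigh the high host vertices and the \<open>2 * d\<close> vertices blocked by two
  neighbours.\<close>

lemma stage_one_bound:
  assumes la: "4 * la \<le> 5 * (K * K) + 2 * K - 10"
  shows "3 * H + 6 * d + 2 * la + 2 * l \<le> n"
proof -
  define e where "e = 6 * d + 2 * la"
  have e: "2 * e \<le> 5 * (K * K) + 32 * K - 46" using la d unfolding e_def by simp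
  have "(4 * K - 3) * (2 * e) \<le> (4 * K - 3) * (5 * (K * K) + 32 * K - 46)"
    using e K by (intro mult_left_mono) auto
  then have 1: "(4 * K - 3) * (2 * e) \<le> 20 * (K * K * K) + 113 * (K * K) - 280 * K + 138"
    by (simp add: algebra_simps)
  then have 1: "8 * (K * e) - 6 * e \<le> 20 * (K * K * K) + 113 * (K * K) - 280 * K + 138"
    by (simp add: algebra_simps)
  have K3: "0 \<le> K * K * K" using K by simp
  have 2: "3 * ((K - 2) * N) \<le> 3 * (K - 2) * n + 3 * (K * K) - 6 * K"
    using mult_left_mono[OF N(2), of "3 * (K - 2)"] K by (simp add: algebra_simps)
  have "3 * (K * n) - 6 * n + 3 * (K * K) - 6 * K + 4 * (K * e) - 3 * e + 8 * (K * l) - 6 * l \<le> 4 * (K * n) - 3 * n"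
    using l_cases
  proof
    assume "l \<le> 0"
    then have "(4 * K - 3) * l \<le> 0" using K by (intro mult_nonneg_nonpos) auto
    then have l0: "4 * (K * l) - 3 * l \<le> 0" by (simp add: algebra_simps)
    \<comment> \<open>After multiplication by \<open>4 * K - 3\<close>, the high vertices use up
      \<open>3 * (K - 2)\<close> of the factor of \<open>n\<close>, and \<open>K + 3\<close>
      remains.\<close>
    have "(K + 3) * (20 * (K * K)) \<le> (K + 3) * n" using n K by (intro mult_left_mono) auto
    then have "20 * (K * K * K) + 60 * (K * K) \<le> K * n + 3 * n" by (simp add: algebra_simps)
    then show ?thesis using 1 l0 K KK K3 by linarith
  next
    assume a: "1 \<le> l \<and> 54 * (K * K) \<le> n \<and> 216 * l \<le> n"
    have "(4 * K - 3) * (216 * l) \<le> (4 * K - 3) * n" using a K by (intro mult_left_mono) auto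
    then have 3: "864 * (K * l) - 648 * l \<le> 4 * (K * n) - 3 * n" by (simp add: algebra_simps)
    have "(K + 3) * (54 * (K * K)) \<le> (K + 3) * n" using a K by (intro mult_left_mono) auto
    then have "54 * (K * K * K) + 162 * (K * K) \<le> K * n + 3 * n" by (simp add: algebra_simps)
    moreover have "0 \<le> n" using KK n by linarith
    moreover have "0 \<le> K * n" using \<open>0 \<le> n\<close> K by simp
    ultimately show ?thesis using 1 3 K KK K3 by linarith
  qed
  then have "(4 * K - 3) * (3 * H + e + 2 * l) \<le> (4 * K - 3) * n"
    using 2 H by (simp add: algebra_simps)
  then have "3 * H + e + 2 * l \<le> n" using K by (simp add: mult_le_cancel_left)
  then show ?thesis unfolding e_def by simp
qed

text \<open>The final contradiction for guests with few leaves: \<open>w\<close> counts the guest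
  vertices placed on complement neighbours of one host vertex of degree below
  \<open>n / 16\<close>.\<close>

lemma cover_bound:
  assumes "4 * la \<le> 5 * (K * K) + 2 * K - 10" "16 * w < n" "y \<le> 9 * (K - 2)"
  shows "6 * w + 5 * la + 8 * l + 6 * d + 3 * y \<le> n"
proof -
  have "0 \<le> (2 * K - 7) * (2 * K - 7)" "0 \<le> (K - 5) * (K - 5)" by simp_all
  then have "28 * K \<le> 4 * (K * K) + 49" "10 * K \<le> K * K + 25" by (simp_all add: algebra_simps)
  then show ?thesis using l_cases assms n d KK K by auto
qed

text \<open>The factor 45 is \<open>5 * 9\<close>: a fifth of the path-like vertices must still
  number \<open>9 * (K - 2)\<close>, the bound from \<open>few_high\<close>.\<close>

lemma many_path_like:
  assumes "4 * la \<le> 5 * (K * K) + 2 * K - 10"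
  shows "45 * (K - 2) + 10 * la + 14 * l \<le> n"
proof -
  have "0 \<le> (3 * K - 11) * (3 * K - 11)" by simp_all
  then have "66 * K \<le> 9 * (K * K) + 121" by (simp_all add: algebra_simps)
  then show ?thesis using l_cases assms n d KK K by auto
qed

text \<open>\<open>y\<close> counts host vertices of complement degree at least
  \<open>n / 16\<close>; the hypothesis is \<open>card_high_degree\<close> for that
  threshold.\<close>

lemma few_high:
  assumes "y * n \<le> 8 * ((K - 2) * (N + y))"
  shows "y \<le> 9 * (K - 2)"
proof (rule ccontr)
  assume "\<not> ?thesis"
  then have y: "9 * (K - 2) + 1 \<le> y" by simp
  have "8 * K - 16 \<le> n" using n KK K by linarith
  then have p: "0 \<le> n - 8 * (K - 2)" by simp
  have "(9 * (K - 2) + 1) * (n - 8 * (K - 2)) \<le> y * (n - 8 * (K - 2))"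
    using y p by (intro mult_right_mono) auto
  also have "\<dots> \<le> 8 * ((K - 2) * N)" using assms by (simp add: algebra_simps)
  also have "\<dots> \<le> 8 * ((K - 2) * (n + K))" using N K by (intro mult_left_mono) auto
  finally have "K * n - n \<le> 80 * (K * K) - 296 * K + 272" by (simp add: algebra_simps)
  moreover have "(K - 1) * (20 * (K * K)) \<le> (K - 1) * n" using n K by (intro mult_left_mono) auto
  then have "20 * (K * K * K) - 20 * (K * K) \<le> K * n - n" by (simp add: algebra_simps)
  ultimately have "20 * (K * K * K) + 296 * K \<le> 100 * (K * K) + 272" by simp
  \<comment> \<open>Five times this product cancels the cubic and quadratic terms and leaves a
    linear inequality that fails for \<open>K \<ge> 2\<close>.\<close>
  moreover have "0 \<le> (K - 2) * ((2 * K - 3) * (2 * K - 3))" using K by simp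
  then have "0 \<le> 4 * (K * K * K) - 20 * (K * K) + 33 * K - 18" by (simp add: algebra_simps)
  ultimately show False using K by linarith
qed

text \<open>Doubled form of the room needed to place at most \<open>18 * (K - 2)\<close> vertices,
  each facing at most \<open>(N + K) / 2\<close> vertices blocked by one high vertex and
  \<open>2 * d\<close> by two low ones.\<close>

lemma neighbour_stage_bound: "36 * (K - 2) + K + 4 * d + 2 * H \<le> N"
proof -
  have "0 \<le> (K - 2) * (K - 2)" "0 \<le> (K - 3) * (K - 3)" by simp_all
  then have "4 * K \<le> K * K + 4" "6 * K \<le> K * K + 9" by (simp_all add: algebra_simps)
  then have "36 * K - 72 + K + 4 * d + 2 * H \<le> N" using H_quarter n N d KK K by linarith
  then show ?thesis by simp
qed

text \<open>Room for the dense core found by \<open>elimination\<close>. The product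
  \<open>x * d\<close> is at most the square root of \<open>n\<close>, because
  \<open>54 * (K * K) * l \<le> n\<close>, and hence at most \<open>n / 14\<close>, because
  \<open>n \<ge> 216\<close>.\<close>

lemma exceptional_bound:
  assumes "t \<le> 2 * l" "1 \<le> t" "0 \<le> x" "x * x \<le> 6 * l"
  shows "t + x * d + 20 * K + H \<le> N"
proof -
  have l1: "1 \<le> l \<and> 54 * (K * K) \<le> n \<and> 216 * l \<le> n" using l_cases assms by linarith
  define p where "p = x * d"
  have "2 * d \<le> 5 * K" using d K by linarith
  then have "(2 * d) * (2 * d) \<le> (5 * K) * (5 * K)" by (rule mult_mono) (use d K in auto)
  then have dd: "4 * (d * d) \<le> 25 * (K * K)" by (simp add: algebra_simps)
  have "(x * x) * (4 * (d * d)) \<le> (6 * l) * (25 * (K * K))"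
    by (rule mult_mono) (use assms dd l1 in auto)
  also have "\<dots> = 150 * (K * K * l)" by (simp add: algebra_simps)
  also have "\<dots> \<le> 4 * (54 * (K * K) * l)" using l1 K by simp
  also have "\<dots> \<le> 4 * n" using l by simp
  finally have p: "p * p \<le> n" unfolding p_def by (simp add: algebra_simps)
  have "14 * p \<le> n"
  proof (rule ccontr)
    assume "\<not> ?thesis"
    then have a: "n < 14 * p" by simp
    then have p14: "p < 14" 
    proof -
      have "p * p < 14 * p" using a p by simp
      moreover have "0 < p" using a l1 KK by linarith
      ultimately show ?thesis by simp
    qed
    then show False using a l1 KK by linarith
  qed
  then show ?thesis using H_quarter N l1 KK K assms unfolding p_def by linarith
qed

end

section \<open>Guests with many leaves\<close>

locale packing = G: sparse_graph VG A l + B: path_free V E k r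
  for VG :: "'a set" and A and l :: int and V :: "'b set" and E and k r :: nat +
  assumes n_large: "20 * (k * k) \<le> card VG"
    and l_small: "54 * (int k * int k) * l \<le> int (card VG)"
    and N_lower: "card VG + r \<le> card V + 1"
    and N_upper: "card V \<le> card VG + k"
begin

definition bdg :: "'b \<Rightarrow> nat" where "bdg w = card (nbs E V w)"
text \<open>About \<open>5 * k / 2\<close>: large enough that at most a quarter of the host vertices
  exceed it, and that a hub with more than \<open>d\<close> leaves frees the room needed in
  \<open>embed_hub_in_component\<close>.\<close>

definition d :: nat where "d = 2 * k + r - 3"
definition low :: "'b set" where "low = {w \<in> V. bdg w \<le> d}"
text \<open>If no vertex has more than \<open>d\<close> leaves, a violation of Hall's condition for the leaves bounds their
  number by \<open>mu\<close>: at most \<open>r\<close> vertices carry all but \<open>d - r\<close> of them.\<close>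

definition mu :: nat where "mu = (r + 1) * d - r"
definition leaves_at :: "'a \<Rightarrow> 'a set" where "leaves_at v = G.leaves \<inter> nbs A VG v"

lemma d_eq: "int d = 2 * int k + int r - 3" and d_ge: "r \<le> d + 1" and d_pos: "2 \<le> d"
  using B.k2 B.r_pos unfolding d_def by auto

lemma low_subset: "low \<subseteq> V" and finite_low: "finite low"
  using B.fin unfolding low_def by auto

lemma N_ge: "card VG \<le> card V" using N_lower B.r_pos by linarith

text \<open>From \<open>card_high_degree\<close> with threshold \<open>d + 1\<close>, moving the
  share of the high vertices to the left:
  \<open>2 * (d + 1) - (k - 2) \<ge> 4 * k - 3\<close>.\<close>

lemma high_count: "(4 * int k - 3) * int (card (V - low)) \<le> (int k - 2) * int (card V)"
proof -
  have "2 * (d + 1) * card (V - low) \<le> (k - 2) * (card V + card (V - low))"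
    by (rule B.card_high_degree) (auto simp: low_def bdg_def)
  then have a: "int (2 * (d + 1) * card (V - low)) \<le> int ((k - 2) * (card V + card (V - low)))"
    by (rule zle_int[THEN iffD2])
  have k2: "int (k - 2) = int k - 2" using B.k2 by simp
  have "int ((k - 2) * (card V + card (V - low))) = (int k - 2) * (int (card V) + int (card (V - low)))"
    unfolding of_nat_mult of_nat_add k2 ..
  moreover have "int (2 * (d + 1) * card (V - low)) = 2 * (int d + 1) * int (card (V - low))"
    by (simp add: algebra_simps)
  ultimately have "2 * (int d + 1) * int (card (V - low)) \<le> (int k - 2) * (int (card V) + int (card (V - low)))"
    using a by metis
  then have 1: "2 * (int d + 1) * int (card (V - low)) \<le>
      (int k - 2) * int (card V) + (int k - 2) * int (card (V - low))"
    by (simp add: algebra_simps)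
  have "int k - 1 \<le> 2 * int r" using B.k_le by linarith
  then have "4 * int k - 3 \<le> 2 * (int d + 1) - (int k - 2)" unfolding d_eq by simp
  then have "(4 * int k - 3) * int (card (V - low)) \<le> (2 * (int d + 1) - (int k - 2)) * int (card (V - low))"
    by (rule mult_right_mono) simp
  then show ?thesis using 1 by (simp add: algebra_simps)
qed

lemma nums: "2 \<le> int k" "20 * (int k * int k) \<le> int (card VG)"
  "int (card VG) \<le> int (card V)" "int (card V) \<le> int (card VG) + int k"
  "0 \<le> int d" "2 * int d \<le> 5 * int k - 6"
proof -
  show "20 * (int k * int k) \<le> int (card VG)" using n_large by (metis of_nat_le_iff of_nat_mult of_nat_numeral)
qed (use B.k2 N_ge N_upper B.r_le in \<open>auto simp: d_eq\<close>)

lemmas numeric = nums(1,2) l_small nums(3,4) high_count nums(5,6)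

lemma n_ge: "80 \<le> card VG"
  using KK(1)[OF numeric] nums(2) by linarith

lemma card_low: "card V = card low + card (V - low)"
  using low_subset B.fin by (metis card_Diff_subset card_mono finite_low le_add_diff_inverse)

text \<open>\<open>main\<close> serves the vertices with at most two earlier neighbours. In the
  dense core, \<open>exceptional_bound\<close> leaves a margin of \<open>20 * k\<close>:
  \<open>19 * k\<close> for low vertices missing from \<open>L\<close> and \<open>k\<close> for
  those blocked by \<open>Q\<close>.\<close>

lemma embed_rest:
  assumes f: "emb A E V f Q" and T: "T \<subseteq> VG" "Q \<inter> T = {}"
    and L: "L \<subseteq> V" "L \<inter> f ` Q = {}" and e: "e \<le> d" "\<And>w. w \<in> L \<Longrightarrow> bdg w \<le> e"
    and main: "\<And>x T'. T' \<subseteq> T \<Longrightarrow> x \<in> T' \<Longrightarrow> card (nbs A T' x) \<le> 2 \<Longrightarrow>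
      card T + card {w \<in> L. \<exists>q\<in>Q. A x q \<and> E (f q) w} + card (nbs A T' x) * e \<le> card L"
    and exc: "\<And>x T'. T' \<subseteq> T \<Longrightarrow> x \<in> T' \<Longrightarrow> 3 \<le> card (nbs A T' x) \<Longrightarrow>
      card {w \<in> L. \<exists>q\<in>Q. A x q \<and> E (f q) w} \<le> k"
    and large: "card V \<le> card L + card (V - low) + 19 * k"
  shows "\<exists>g. emb A E V g (Q \<union> T) \<and> (\<forall>q\<in>Q. g q = f q) \<and> g ` T \<subseteq> L"
proof (rule emb_greedy[where d = e])
  show "A x y \<Longrightarrow> A y x" for x y by (rule G.sym)
  show "\<not> A x x" for x by (rule G.irrefl)
  show "E x y \<Longrightarrow> E y x" for x y by (rule B.sym)
  show "finite T" using T G.finite_sub by blast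
  show finL: "finite L" using L B.finite_sub by blast
  show "card (nbs E L w) \<le> e" if "w \<in> L" for w
    using e(2)[OF that] card_nbs_mono[OF B.fin L(1), of E w] unfolding bdg_def by simp
  fix T' assume T': "T' \<subseteq> T" "T' \<noteq> {}"
  have le: "card T' \<le> card T" using T' T G.finite_sub by (intro card_mono) auto
  let ?F = "\<lambda>x. {w \<in> L. \<exists>q\<in>Q. A x q \<and> E (f q) w}"
  obtain x where x: "x \<in> T'" "card (nbs A T' x) \<le> 2 \<or>
    (int (card T') \<le> 2 * l \<and> int (card (nbs A T' x)) * int (card (nbs A T' x)) \<le> 6 * l)"
    using G.elimination[of T'] T' T by blast
  have "card T' + card (?F x) + card (nbs A T' x) * e \<le> card L"
  proof (cases "card (nbs A T' x) \<le> 2")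
    case True
    then show ?thesis using main[OF T'(1) x(1)] le by linarith
  next
    case False
    have "1 \<le> card T'" using x(1) T' T G.finite_sub by (metis One_nat_def Suc_leI card_gt_0_iff empty_iff subset_trans)
    then have "int (card T') + int (card (nbs A T' x)) * int d + 20 * int k + int (card (V - low)) \<le> int (card V)"
      using x(2) False by (intro exceptional_bound[OF numeric]) auto
    then have "int (card T' + card (nbs A T' x) * d + 20 * k + card (V - low)) \<le> int (card V)" by simp
    then have "card T' + card (nbs A T' x) * d + 20 * k + card (V - low) \<le> card V" by (rule zle_int[THEN iffD1])
    moreover have "card (nbs A T' x) * e \<le> card (nbs A T' x) * d" using e(1) by (rule mult_le_mono2)
    moreover have "card (?F x) \<le> k" using exc[OF T'(1) x(1)] False by simp
    ultimately show ?thesis using large by linarith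
  qed
  then show "\<exists>x\<in>T'. card T' + card (?F x) + card (nbs A T' x) * e \<le> card L" using x(1) by blast
qed (use f T L in auto)

lemma blocked_subset:
  assumes "L \<subseteq> V" and that: "finite Q"
  shows "card {w \<in> L. \<exists>q\<in>Q. A x q \<and> E (f q) w} \<le> (\<Sum>q\<in>nbs A Q x. bdg (f q))"
proof -
  have "card {w \<in> L. \<exists>q\<in>Q. A x q \<and> E (f q) w} \<le> card (\<Union>q\<in>nbs A Q x. nbs E V (f q))"
  proof (rule card_mono)
    show "{w \<in> L. \<exists>q\<in>Q. A x q \<and> E (f q) w} \<subseteq> (\<Union>q\<in>nbs A Q x. nbs E V (f q))"
    proof
      fix w assume "w \<in> {w \<in> L. \<exists>q\<in>Q. A x q \<and> E (f q) w}"
      then obtain q where "q \<in> nbs A Q x" "w \<in> nbs E V (f q)" using assms(1) by auto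
      then show "w \<in> (\<Union>q\<in>nbs A Q x. nbs E V (f q))" by blast
    qed
  qed (use that B.fin in auto)
  also have "\<dots> \<le> (\<Sum>q\<in>nbs A Q x. bdg (f q))"
    unfolding bdg_def using that by (intro card_UN_le) auto
  finally show ?thesis .
qed

text \<open>Leaves and an independent set \<open>Z\<close> of vertices of degree two are kept aside
  while the rest goes greedily into low vertices. Then \<open>Z\<close> may use any free vertex:
  each of its vertices sees at most \<open>2 * d\<close> blocked ones, and the space reserved for
  more than \<open>mu\<close> leaves covers this. \<open>Q\<close> is empty or holds a hub placed in
  advance.\<close>

lemma embed_without_leaves:
  assumes leaves: "mu < card G.leaves"
    and Q: "Q \<subseteq> VG" "card Q \<le> 1" "\<And>q. q \<in> Q \<Longrightarrow> 3 \<le> G.dg q"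
    and f: "emb A E V f Q" "\<And>q. q \<in> Q \<Longrightarrow> bdg (f q) < r"
  shows "\<exists>g. emb A E V g (VG - G.leaves) \<and> (\<forall>q\<in>Q. g q = f q) \<and>
    (\<forall>x\<in>G.leaves. \<forall>y\<in>nbs A VG x. bdg (g y) \<le> d)"
proof -
  have finQ: "finite Q" using Q G.finite_sub by blast
  have n2: "2 \<le> card VG" and n3: "3 \<le> card VG" using n_ge by auto
  \<comment> \<open>Neighbours of leaves are kept out of \<open>Z\<close>, so that their images have
    degree at most \<open>d\<close>.\<close>
  define S where "S = (\<Union>x\<in>G.leaves. nbs A VG x)"
  have finS: "finite S" unfolding S_def using G.fin G.finite_leaves by simp
  have "card S \<le> (\<Sum>x\<in>G.leaves. card (nbs A VG x))" unfolding S_def using G.finite_leaves by (rule card_UN_le)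
  also have "\<dots> = card G.leaves" by (simp add: G.leaves_def G.dg_def)
  finally have cS: "card S \<le> card G.leaves" .
  define T2 where "T2 = {x \<in> VG. G.dg x = 2} - S"
  have finT2: "finite T2" unfolding T2_def using G.fin by simp
  have "VG \<subseteq> (G.leaves \<union> G.big) \<union> (S \<union> T2)"
    using G.not_two_eq[OF n2] unfolding T2_def by blast
  then have "card VG \<le> card ((G.leaves \<union> G.big) \<union> (S \<union> T2))"
    using finS finT2 G.finite_leaves G.finite_big by (intro card_mono) auto
  also have "\<dots> \<le> (card G.leaves + card G.big) + (card S + card T2)"
    by (meson add_le_mono card_Un_le le_trans)
  finally have "int (card VG) \<le> 3 * int (card G.leaves) + 2 * l + int (card T2)"
    using cS G.card_big[OF n2] by linarith
  moreover have "\<exists>I\<subseteq>T2. (\<forall>x\<in>I. \<forall>y\<in>I. x \<noteq> y \<longrightarrow> \<not> A x y) \<and> card T2 \<le> (2 + 1) * card I"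
  proof (rule conflict_free_subset[OF finT2])
    fix x assume x: "x \<in> T2"
    have "{y \<in> T2. A x y} \<subseteq> nbs A VG x" unfolding T2_def by auto
    then have "card {y \<in> T2. A x y} \<le> G.dg x" unfolding G.dg_def using G.fin by (intro card_mono) auto
    then show "card {y \<in> T2. A x y} \<le> 2" using x unfolding T2_def by simp
  qed (rule G.sym)
  then obtain Z where Z: "Z \<subseteq> T2" "\<forall>x\<in>Z. \<forall>y\<in>Z. x \<noteq> y \<longrightarrow> \<not> A x y" "card T2 \<le> 3 * card Z" by auto
  ultimately have cZ: "int (card VG) \<le> 3 * int (card G.leaves) + 2 * l + 3 * int (card Z)" by linarith
  have finZ: "finite Z" using Z finT2 finite_subset by blast
  have Zdis: "Z \<inter> G.leaves = {}" "Z \<inter> Q = {}" "Z \<subseteq> VG"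
    using Z Q(3) unfolding T2_def G.leaves_def by fastforce+
  have Qdis: "Q \<inter> G.leaves = {}" using Q(3) unfolding G.leaves_def by fastforce
  define T where "T = VG - G.leaves - Z - Q"
  have finT: "finite T" unfolding T_def using G.fin by simp
  have LsubVG: "G.leaves \<subseteq> VG" unfolding G.leaves_def by auto
  have "card VG = card (T \<union> (Q \<union> (G.leaves \<union> Z)))"
    using Q(1) Zdis LsubVG unfolding T_def by (intro arg_cong[of _ _ card]) auto
  also have "\<dots> = card T + (card Q + (card G.leaves + card Z))"
    using finT finQ finZ G.finite_leaves Zdis Qdis unfolding T_def
    by (subst card_Un_disjoint, force, force, force)+ simp
  finally have cT: "card VG = card T + card Q + card G.leaves + card Z" by simp
  have fQ: "f ` Q \<subseteq> low" using f d_ge unfolding emb_def low_def by fastforce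
  have cfQ: "card (f ` Q) = card Q" using f(1) unfolding emb_def by (simp add: card_image)
  define L where "L = low - f ` Q"
  have cL: "card low = card L + card Q"
    unfolding L_def using fQ cfQ finite_low finQ by (metis card_Diff_subset card_mono finite_imageI le_add_diff_inverse2)
  have F: "card {w \<in> L. \<exists>q\<in>Q. A x q \<and> E (f q) w} \<le> r - 1" for x
  proof -
    have "card {w \<in> L. \<exists>q\<in>Q. A x q \<and> E (f q) w} \<le> (\<Sum>q\<in>nbs A Q x. bdg (f q))"
      using finQ low_subset unfolding L_def by (intro blocked_subset) auto
    also have "\<dots> \<le> card (nbs A Q x) * (r - 1)"
      using sum_bounded_above[of "nbs A Q x" "\<lambda>q. bdg (f q)" "r - 1"] f(2) by fastforce
    also have "\<dots> \<le> card Q * (r - 1)" using finQ by (intro mult_le_mono1 card_mono) auto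
    also have "\<dots> \<le> 1 * (r - 1)" using Q(2) by (rule mult_le_mono1)
    finally show ?thesis by simp
  qed
  have b: "3 * card (V - low) + 6 * d + 2 * l \<le> int (card VG)"
    using stage_one_bound[OF numeric, of 0] KK[OF numeric] nums(1) by simp
  have "\<exists>g. emb A E V g (Q \<union> T) \<and> (\<forall>q\<in>Q. g q = f q) \<and> g ` T \<subseteq> L"
  proof (rule embed_rest[where e = d])
    fix x T' assume "T' \<subseteq> T" "x \<in> T'"
    { assume "card (nbs A T' x) \<le> 2"
      then have "card (nbs A T' x) * d \<le> 2 * d" by (rule mult_le_mono1)
      then show "card T + card {w \<in> L. \<exists>q\<in>Q. A x q \<and> E (f q) w} + card (nbs A T' x) * d \<le> card L"
        using F[of x] cT cL card_low b cZ N_lower B.r_pos by linarith }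
    show "card {w \<in> L. \<exists>q\<in>Q. A x q \<and> E (f q) w} \<le> k" using F[of x] B.r_le by linarith
  next
    show "card V \<le> card L + card (V - low) + 19 * k" using cL card_low Q(2) B.k2 by linarith
  qed (use f low_subset in \<open>auto simp: T_def L_def low_def\<close>)
  then obtain g where g: "emb A E V g (Q \<union> T)" "\<forall>q\<in>Q. g q = f q" "g ` T \<subseteq> L" by blast
  have glow: "bdg (g y) \<le> d" if "y \<in> Q \<union> T" for y
    using g(2,3) fQ that unfolding L_def low_def by auto
  define U where "U = V - g ` (Q \<union> T)"
  have "card (g ` (Q \<union> T)) = card (Q \<union> T)" using g(1) unfolding emb_def by (simp add: card_image)
  also have "\<dots> = card Q + card T" using finQ finT unfolding T_def by (subst card_Un_disjoint) auto
  finally have "card V = card U + (card Q + card T)"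
    unfolding U_def using g(1) B.fin finQ finT unfolding emb_def
    by (metis card_Diff_subset card_mono finite_UnI finite_imageI le_add_diff_inverse2)
  then have cU: "card Z + 2 * d \<le> card U"
  proof -
    assume a: "card V = card U + (card Q + card T)"
    have "2 * d \<le> (r + 1) * d" using B.r_pos by (intro mult_le_mono1) simp
    then have "2 * d \<le> mu + r" unfolding mu_def by linarith
    then show ?thesis using a cT leaves N_lower by linarith
  qed
  have "\<exists>h. emb A E V h ((Q \<union> T) \<union> Z) \<and> (\<forall>q\<in>Q \<union> T. h q = g q) \<and> h ` Z \<subseteq> U"
  \<comment> \<open>The degree bound is multiplied by a number of neighbours inside
    \<open>Z\<close>, which is zero, so the trivial bound serves.\<close>
  proof (rule emb_greedy[where d = "card V"])
    show "A x y \<Longrightarrow> A y x" for x y by (rule G.sym)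
    show "\<not> A x x" for x by (rule G.irrefl)
    show "E x y \<Longrightarrow> E y x" for x y by (rule B.sym)
    show "card (nbs E U w) \<le> card V" for w using B.fin unfolding U_def by (intro card_mono) auto
    fix T' assume T': "T' \<subseteq> Z" "T' \<noteq> {}"
    then obtain x where x: "x \<in> T'" by blast
    have "nbs A T' x = {}"
    proof (rule equals0I)
      fix y assume "y \<in> nbs A T' x"
      then have y: "y \<in> T'" "A x y" by auto
      then have "x \<noteq> y" using G.irrefl by metis
      then show False using Z(2) T'(1) x y by blast
    qed
    moreover have "card {w \<in> U. \<exists>q\<in>Q \<union> T. A x q \<and> E (g q) w} \<le> 2 * d"
    proof -
      have "card {w \<in> U. \<exists>q\<in>Q \<union> T. A x q \<and> E (g q) w} \<le> (\<Sum>q\<in>nbs A (Q \<union> T) x. bdg (g q))"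
        using finQ finT unfolding U_def by (intro blocked_subset) auto
      also have "\<dots> \<le> card (nbs A (Q \<union> T) x) * d"
        using sum_bounded_above[of "nbs A (Q \<union> T) x" "\<lambda>q. bdg (g q)" d] glow by auto
      also have "card (nbs A (Q \<union> T) x) \<le> G.dg x"
        unfolding G.dg_def using Q(1) G.fin unfolding T_def by (intro card_mono) auto
      also have "G.dg x = 2" using x T'(1) Z(1) unfolding T2_def by auto
      finally show ?thesis by simp
    qed
    moreover have "card T' \<le> card Z" using T'(1) finZ by (intro card_mono) auto
    ultimately show "\<exists>x\<in>T'. card T' + card {w \<in> U. \<exists>q\<in>Q \<union> T. A x q \<and> E (g q) w} + card (nbs A T' x) * card V \<le> card U"
      using x cU by (intro bexI[of _ x]) auto
  qed (use g(1) finZ Zdis B.fin in \<open>auto simp: T_def U_def\<close>)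
  then obtain h where h: "emb A E V h ((Q \<union> T) \<union> Z)" "\<forall>q\<in>Q \<union> T. h q = g q" by blast
  have eq: "(Q \<union> T) \<union> Z = VG - G.leaves" using Q(1) Zdis Qdis unfolding T_def by auto
  have "bdg (h y) \<le> d" if "x \<in> G.leaves" "y \<in> nbs A VG x" for x y
  proof -
    have "y \<notin> G.leaves" using G.leaves_not_adjacent[OF n3 that(1)] that(2) by auto
    moreover have "y \<notin> Z" using that Z(1) unfolding T2_def S_def by auto
    ultimately have "y \<in> Q \<union> T" using that(2) eq by auto
    then show ?thesis using h(2) glow by simp
  qed
  moreover have "\<forall>q\<in>Q. h q = f q" using h(2) g(2) by simp
  ultimately show ?thesis using h(1) unfolding eq by blast
qed

end

section \<open>Placing the leaves\<close>

context packing begin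

text \<open>\<open>U\<close> consists of the free vertices that are candidates for no leaf in
  \<open>J\<close>. At least \<open>card G.leaves + r - 1\<close> vertices are free and fewer than
  \<open>card J\<close> are candidates, which gives the size of \<open>U\<close>.\<close>

lemma hall_leaves_violation:
  assumes g: "emb A E V g (VG - G.leaves)" and no: "\<And>h. \<not> emb A E V h VG"
  obtains J U where "J \<subseteq> G.leaves" "J \<noteq> {}" "U \<subseteq> V" "U \<inter> g ` (VG - G.leaves) = {}"
    "r + card (G.leaves - J) \<le> card U"
    "\<And>u x y. u \<in> U \<Longrightarrow> x \<in> J \<Longrightarrow> y \<in> nbs A VG x \<Longrightarrow> E (g y) u"
proof -
  let ?S = "VG - G.leaves"
  have n3: "3 \<le> card VG" using n_ge by simp
  have LV: "G.leaves \<subseteq> VG" unfolding G.leaves_def by auto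
  define U where "U = V - g ` ?S"
  have finU: "finite U" unfolding U_def using B.fin by simp
  have "card (g ` ?S) = card ?S" using g unfolding emb_def by (simp add: card_image)
  moreover have "card VG = card ?S + card G.leaves"
    using LV G.fin G.finite_leaves by (metis card_Diff_subset card_mono le_add_diff_inverse2)
  moreover have "card V = card U + card (g ` ?S)"
    unfolding U_def using g B.fin G.fin unfolding emb_def
    by (metis card_Diff_subset card_mono finite_Diff finite_imageI le_add_diff_inverse2)
  ultimately have cU: "card G.leaves + r \<le> card U + 1" using N_lower by linarith
  define al where "al J = {u \<in> U. \<exists>z\<in>J. \<forall>y\<in>?S. A z y \<longrightarrow> \<not> E (g y) u}" for J
  have "\<exists>J\<subseteq>G.leaves. J \<noteq> {} \<and> card (al J) < card J"
  proof (rule ccontr)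
    assume n: "\<not> ?thesis"
    have "\<exists>h. emb A E V h (?S \<union> G.leaves) \<and> (\<forall>s\<in>?S. h s = g s) \<and> h ` G.leaves \<subseteq> U"
    proof (rule emb_hall)
      show "A x y \<Longrightarrow> A y x" for x y by (rule G.sym)
      show "E x y \<Longrightarrow> E y x" for x y by (rule B.sym)
      show "\<not> A x y" if "x \<in> G.leaves" "y \<in> G.leaves" for x y by (rule G.leaves_not_adjacent[OF n3 that])
      show "card J \<le> card {u \<in> U. \<exists>z\<in>J. \<forall>y\<in>?S. A z y \<longrightarrow> \<not> E (g y) u}" if "J \<subseteq> G.leaves" "J \<noteq> {}" for J
        using n that unfolding al_def by (meson not_le)
    qed (use g G.finite_leaves finU in \<open>auto simp: U_def\<close>)
    moreover have "?S \<union> G.leaves = VG" using LV by blast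
    ultimately show False using no by auto
  qed
  then obtain J where J: "J \<subseteq> G.leaves" "J \<noteq> {}" "card (al J) < card J" by blast
  have alU: "al J \<subseteq> U" unfolding al_def by auto
  have "card (U - al J) = card U - card (al J)"
    using alU finU by (simp add: card_Diff_subset finite_subset)
  moreover have "card (al J) \<le> card U" using alU finU by (rule card_mono[rotated])
  moreover have "card G.leaves = card J + card (G.leaves - J)"
    using J G.finite_leaves by (metis card_Diff_subset card_mono finite_subset le_add_diff_inverse)
  ultimately have "r + card (G.leaves - J) \<le> card (U - al J)" using cU J(3) by linarith
  \<comment> \<open>A leaf has a single neighbour, so a blocked leaf is blocked by that neighbour's
    image.\<close>
  moreover have "E (g y) u" if u: "u \<in> U - al J" and x: "x \<in> J" and y: "y \<in> nbs A VG x" for u x y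
  proof -
    obtain y' where y': "y' \<in> ?S" "A x y'" "E (g y') u" using u x unfolding al_def by auto
    have "x \<in> G.leaves" using x J(1) by blast
    then obtain z where z: "nbs A VG x = {z}" by (rule G.leaf_neighbour)
    have "y' \<in> nbs A VG x" using y' by simp
    then show ?thesis using z y y'(3) by simp
  qed
  ultimately show ?thesis using that[OF J(1,2), of "U - al J"] unfolding U_def by blast
qed

lemma violation_size:
  assumes "J \<subseteq> G.leaves" "x \<in> J" "y \<in> nbs A VG x" "U \<subseteq> V"
    and "\<And>u x y. u \<in> U \<Longrightarrow> x \<in> J \<Longrightarrow> y \<in> nbs A VG x \<Longrightarrow> E (g y) u"
  shows "card U \<le> bdg (g y)"
  unfolding bdg_def using assms B.fin by (intro card_mono) auto

text \<open>In a violation the images of the neighbours of \<open>J\<close> are completely joined to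
  \<open>U\<close>, so there are at most \<open>r\<close> of them and
  \<open>card J \<le> r * d\<close>. Each image has degree at most \<open>d\<close>, so
  \<open>card U \<le> d\<close> and at most \<open>d - r\<close> leaves lie outside
  \<open>J\<close>. The total is at most \<open>mu\<close>.\<close>

lemma embed_spread_leaves:
  assumes leaves: "mu < card G.leaves" and small: "\<And>v. v \<in> VG \<Longrightarrow> card (leaves_at v) \<le> d"
  shows "\<exists>h. emb A E V h VG"
proof (rule ccontr)
  assume "\<not> ?thesis"
  then have no: "\<And>h. \<not> emb A E V h VG" by blast
  obtain g where g: "emb A E V g (VG - G.leaves)"
    and gl: "\<And>x y. x \<in> G.leaves \<Longrightarrow> y \<in> nbs A VG x \<Longrightarrow> bdg (g y) \<le> d"
    using embed_without_leaves[OF leaves, of "{}" undefined] by (auto simp: emb_def)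
  obtain J U where J: "J \<subseteq> G.leaves" "J \<noteq> {}" and U: "U \<subseteq> V" "U \<inter> g ` (VG - G.leaves) = {}"
    and card: "r + card (G.leaves - J) \<le> card U"
    and e: "\<And>u x y. u \<in> U \<Longrightarrow> x \<in> J \<Longrightarrow> y \<in> nbs A VG x \<Longrightarrow> E (g y) u"
    by (rule hall_leaves_violation[OF g no]) blast
  obtain x where x: "x \<in> J" using J by blast
  obtain y where y: "nbs A VG x = {y}" by (rule G.leaf_neighbour[of x]) (use x J in auto)
  have "card U \<le> bdg (g y)" by (rule violation_size[OF J(1) x _ U(1) e]) (use y in auto)
  also have "\<dots> \<le> d" using gl[of x y] x J y by auto
  finally have Ud: "card U \<le> d" .
  define P where "P = (\<Union>x\<in>J. nbs A VG x)"
  have finJ: "finite J" using J G.finite_leaves finite_subset by blast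
  have finP: "finite P" unfolding P_def using finJ G.fin by simp
  have n3: "3 \<le> card VG" using n_ge by simp
  have P: "P \<subseteq> VG - G.leaves"
    using G.leaves_not_adjacent[OF n3] J unfolding P_def by auto
  have "card (g ` P) = card P" using g P unfolding emb_def by (meson card_image inj_on_subset)
  moreover have "card (g ` P) \<le> r"
  proof (rule B.complete_bipartite_bound[of U])
    show "g ` P \<subseteq> V" using g P unfolding emb_def by blast
    show "U \<inter> g ` P = {}" using U(2) P by blast
    show "r \<le> card U" using card by simp
    show "E u w" if "u \<in> U" "w \<in> g ` P" for u w
      using e[OF that(1)] that(2) B.sym unfolding P_def by blast
  qed (rule U(1))
  ultimately have cP: "card P \<le> r" by simp
  have "J \<subseteq> (\<Union>v\<in>P. leaves_at v)"
  proof
    fix x assume x: "x \<in> J"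
    then have xl: "x \<in> G.leaves" using J by blast
    then obtain y where y: "nbs A VG x = {y}" "y \<in> VG" "A x y" by (rule G.leaf_neighbour)
    then have "y \<in> P" using x unfolding P_def by auto
    moreover have "x \<in> leaves_at y" using xl y G.sym unfolding leaves_at_def G.leaves_def by auto
    ultimately show "x \<in> (\<Union>v\<in>P. leaves_at v)" by blast
  qed
  moreover have "finite (\<Union>v\<in>P. leaves_at v)"
    using finP G.finite_leaves unfolding leaves_at_def by auto
  ultimately have "card J \<le> card (\<Union>v\<in>P. leaves_at v)" by (simp add: card_mono)
  also have "\<dots> \<le> (\<Sum>v\<in>P. card (leaves_at v))" using finP by (rule card_UN_le)
  also have "\<dots> \<le> card P * d" using sum_bounded_above[of P "\<lambda>v. card (leaves_at v)" d] small P by auto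
  also have "\<dots> \<le> r * d" using cP by (rule mult_le_mono1)
  finally have "card J \<le> r * d" .
  moreover have "card G.leaves = card J + card (G.leaves - J)"
    using J finJ G.finite_leaves by (metis card_Diff_subset card_mono le_add_diff_inverse)
  ultimately show False using leaves card Ud unfolding mu_def by simp
qed

text \<open>The hub is placed on \<open>p\<close>. If \<open>J\<close> contains a leaf of the hub,
  then \<open>p\<close> is joined to all of \<open>U\<close>, which has at least \<open>r\<close>
  vertices. Otherwise all leaves of the hub lie outside \<open>J\<close>, so \<open>U\<close> has
  more than \<open>d\<close> vertices, too many for the image of a leaf's neighbour.\<close>

lemma embed_hub_at_low_vertex:
  assumes leaves: "mu < card G.leaves" and v: "v \<in> VG" "d < card (leaves_at v)"
    and p: "p \<in> V" "bdg p < r"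
  shows "\<exists>h. emb A E V h VG"
proof (rule ccontr)
  assume "\<not> ?thesis"
  then have no: "\<And>h. \<not> emb A E V h VG" by blast
  have "card (leaves_at v) \<le> G.dg v"
    unfolding leaves_at_def G.dg_def using G.fin by (intro card_mono) auto
  then have dv: "3 \<le> G.dg v" using v d_pos by linarith
  then have vl: "v \<notin> G.leaves" unfolding G.leaves_def by simp
  have "emb A E V (\<lambda>_. p) {v}" using p G.irrefl by (simp add: emb_def)
  then obtain g where g: "emb A E V g (VG - G.leaves)" and gv: "g v = p"
    and gl: "\<And>x y. x \<in> G.leaves \<Longrightarrow> y \<in> nbs A VG x \<Longrightarrow> bdg (g y) \<le> d"
    using embed_without_leaves[OF leaves, of "{v}" "\<lambda>_. p"] v(1) dv p by auto
  obtain J U where J: "J \<subseteq> G.leaves" "J \<noteq> {}" and U: "U \<subseteq> V" "U \<inter> g ` (VG - G.leaves) = {}"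
    and card: "r + card (G.leaves - J) \<le> card U"
    and e: "\<And>u x y. u \<in> U \<Longrightarrow> x \<in> J \<Longrightarrow> y \<in> nbs A VG x \<Longrightarrow> E (g y) u"
    by (rule hall_leaves_violation[OF g no]) blast
  show False
  proof (cases "J \<inter> leaves_at v = {}")
    case True
    obtain x where x: "x \<in> J" using J by blast
    obtain y where y: "nbs A VG x = {y}" by (rule G.leaf_neighbour[of x]) (use x J in auto)
    have "card U \<le> bdg (g y)" by (rule violation_size[OF J(1) x _ U(1) e]) (use y in auto)
    also have "\<dots> \<le> d" using gl[of x y] x J y by auto
    finally have "card U \<le> d" .
    moreover have "leaves_at v \<subseteq> G.leaves - J" using True unfolding leaves_at_def by blast
    then have "card (leaves_at v) \<le> card (G.leaves - J)" using G.finite_leaves by (intro card_mono) auto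
    ultimately show False using card v(2) by linarith
  next
    case False
    then obtain x where x: "x \<in> J" "x \<in> leaves_at v" by blast
    then have "v \<in> nbs A VG x" using v(1) G.sym unfolding leaves_at_def by auto
    then have "card U \<le> bdg (g v)" by (intro violation_size[OF J(1) x(1) _ U(1) e]) auto
    then show False using card p(2) gv by simp
  qed
qed

text \<open>If every degree in the host complement is at least \<open>r\<close>, that complement splits into
  components of fewer than \<open>k\<close> vertices. The hub and as many of its non-neighbours as possible
  fill up a smallest component, so that few vertices are lost for the leaves at the hub.\<close>

lemma embed_hub_in_component:
  assumes v: "v \<in> VG" "d < card (leaves_at v)" and deg: "\<And>w. w \<in> V \<Longrightarrow> r \<le> bdg w"
    and I: "I \<subseteq> VG" "v \<notin> I" "\<And>x. x \<in> I \<Longrightarrow> \<not> A v x" "\<And>x y. x \<in> I \<Longrightarrow> y \<in> I \<Longrightarrow> \<not> A x y"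
    and N: "card VG + k \<le> card V + card I + 2 \<or>
      (card VG + k \<le> card V + card I + 3 \<and> \<not> (k - 1) dvd card V)"
  shows "\<exists>h. emb A E V h VG"
proof -
  obtain P where P: "partition_on V P" "\<And>C. C \<in> P \<Longrightarrow> card C < k"
    "\<And>C x y. C \<in> P \<Longrightarrow> x \<in> C \<Longrightarrow> y \<in> V - C \<Longrightarrow> \<not> E x y"
    using B.partition_small_closed[OF order_refl deg[unfolded bdg_def]] by metis
  have V0: "V \<noteq> {}" using N_ge n_ge by auto
  have UP: "\<Union>P = V" and neP: "C \<in> P \<Longrightarrow> C \<noteq> {}" for C using P(1) unfolding partition_on_def by auto
  have finP: "finite P" using P(1) B.fin by (rule finite_elements[rotated])
  have P0: "P \<noteq> {}" using UP V0 by auto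
  obtain C where C: "C \<in> P" and Cmin: "\<And>C'. C' \<in> P \<Longrightarrow> card C \<le> card C'"
    using arg_min_if_finite(1)[OF finP P0, of card] arg_min_least[OF finP P0, of _ card] by metis
  have CV: "C \<subseteq> V" using C UP by blast
  have finC: "finite C" using CV B.finite_sub by blast
  have finI: "finite I" using I(1) G.finite_sub by blast
  have C1: "1 \<le> card C" using neP[OF C] finC by (simp add: Suc_le_eq card_gt_0_iff)
  have Ck: "card C < k" using P(2) C by blast
  have bdg_le: "bdg w \<le> k - 2" if w: "w \<in> V" for w
  proof -
    obtain D where D: "D \<in> P" "w \<in> D" using w UP by blast
    have DV: "D \<subseteq> V" using D UP by blast
    have "nbs E V w \<subseteq> D - {w}" using P(3)[OF D] B.irrefl unfolding nbs_def by blast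
    then have "bdg w \<le> card (D - {w})" unfolding bdg_def using DV B.finite_sub by (intro card_mono) auto
    also have "\<dots> = card D - 1" using D DV B.finite_sub by simp
    also have "\<dots> \<le> k - 2" using P(2)[OF D(1)] by linarith
    finally show ?thesis .
  qed
  \<comment> \<open>This is where divisibility enters: if a smallest part has \<open>k - 1\<close>
    vertices then all parts do, and \<open>k - 1\<close> divides the order of the host; otherwise
    one vertex less has to be filled.\<close>
  have gap: "card C - 1 - card I \<le> card V - card VG"
  proof (cases "card C = k - 1")
    case True
    have "card D = k - 1" if "D \<in> P" for D using Cmin[OF that] P(2)[OF that] True by linarith
    then have "(\<Sum>D\<in>P. card D) = card P * (k - 1)" by simp
    moreover have "card V = (\<Sum>D\<in>P. card D)"
      using P(1) B.fin UP by (metis card_Union_disjoint finite_subset Sup_upper partition_on_def)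
    ultimately have "(k - 1) dvd card V" by simp
    then show ?thesis using N True N_ge by linarith
  next
    case False
    then show ?thesis using N Ck N_ge by linarith
  qed
  \<comment> \<open>\<open>I\<close> is cut down so that together with the hub it fits into
    \<open>C\<close>.\<close>
  obtain I' where I': "I' \<subseteq> I" "card I' = min (card I) (card C - 1)"
    using obtain_subset_with_card_n[of "min (card I) (card C - 1)" I] by (metis min.cobounded1)
  have finI': "finite I'" using I' finI finite_subset by blast
  define Q where "Q = insert v I'"
  have cQ: "card Q = card I' + 1" unfolding Q_def using I(2) I'(1) finI' by (subst card_insert_disjoint) auto
  then have cQC: "card Q \<le> card C" using I'(2) C1 by linarith
  have finQ: "finite Q" unfolding Q_def using finI' by simp
  obtain f0 where f0: "inj_on f0 Q" "f0 ` Q \<subseteq> C"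
    using card_le_inj[OF finQ finC cQC] by blast
  have nA: "\<not> A x y" if "x \<in> Q" "y \<in> Q" for x y
    using that I I'(1) G.irrefl G.sym unfolding Q_def by blast
  have emb0: "emb A E V f0 Q" unfolding emb_def using f0 CV nA by blast
  have LvVG: "leaves_at v \<subseteq> VG" and Lvfin: "finite (leaves_at v)"
    unfolding leaves_at_def G.leaves_def using G.fin by auto
  have LvQ: "leaves_at v \<inter> Q = {}"
    using I(3) I'(1) G.irrefl unfolding Q_def leaves_at_def by auto
  define T where "T = VG - leaves_at v - Q"
  define L where "L = V - f0 ` Q"
  have QVG: "Q \<subseteq> VG" using v(1) I(1) I'(1) unfolding Q_def by blast
  have finT: "finite T" unfolding T_def using G.fin by simp
  have "card VG = card (T \<union> (Q \<union> leaves_at v))"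
    using QVG LvVG unfolding T_def by (intro arg_cong[of _ _ card]) auto
  also have "\<dots> = card T + (card Q + card (leaves_at v))"
    using finT finQ Lvfin LvQ unfolding T_def
    by (subst card_Un_disjoint, force, force, force)+ simp
  finally have cT: "card VG = card T + card Q + card (leaves_at v)" by simp
  have cf0: "card (f0 ` Q) = card Q" using f0(1) by (rule card_image)
  have cL: "card V = card L + card Q"
    unfolding L_def using emb0 B.fin finQ cf0 unfolding emb_def
    by (metis card_Diff_subset card_mono finite_imageI le_add_diff_inverse2)
  have F: "card {w \<in> L. \<exists>q\<in>Q. A x q \<and> E (f0 q) w} \<le> card C - 1" for x
  proof -
    have "{w \<in> L. \<exists>q\<in>Q. A x q \<and> E (f0 q) w} \<subseteq> C - {f0 v}"
      using P(3)[OF C] f0(2) unfolding L_def Q_def by blast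
    then have "card {w \<in> L. \<exists>q\<in>Q. A x q \<and> E (f0 q) w} \<le> card (C - {f0 v})"
      using finC by (intro card_mono) auto
    also have "\<dots> = card C - 1" using f0(2) finC unfolding Q_def by simp
    finally show ?thesis .
  qed
  have kd: "k - 2 \<le> d" unfolding d_def using B.k2 by simp
  have "\<exists>g. emb A E V g (Q \<union> T) \<and> (\<forall>q\<in>Q. g q = f0 q) \<and> g ` T \<subseteq> L"
  proof (rule embed_rest[where e = "k - 2"])
    fix x T' assume "T' \<subseteq> T" "x \<in> T'"
    { assume "card (nbs A T' x) \<le> 2"
      then have "card (nbs A T' x) * (k - 2) \<le> 2 * (k - 2)" by (rule mult_le_mono1)
      moreover have "card T + (card C - 1) + 2 * (k - 2) \<le> card L"
        using cT cL N_lower v(2) Ck B.k2 B.k_le unfolding d_def by linarith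
      ultimately show "card T + card {w \<in> L. \<exists>q\<in>Q. A x q \<and> E (f0 q) w} + card (nbs A T' x) * (k - 2) \<le> card L"
        using F[of x] by linarith }
    show "card {w \<in> L. \<exists>q\<in>Q. A x q \<and> E (f0 q) w} \<le> k" using F[of x] Ck by linarith
  next
    show "card V \<le> card L + card (V - low) + 19 * k" using cL cQC Ck by linarith
  qed (use emb0 kd bdg_le in \<open>auto simp: T_def L_def\<close>)
  then obtain g where g: "emb A E V g (Q \<union> T)" "\<forall>q\<in>Q. g q = f0 q" "g ` T \<subseteq> L" by blast
  \<comment> \<open>The hub's leaves go outside \<open>C\<close>, where no vertex is joined to the
    hub's image. Only the part of \<open>C\<close> not filled by \<open>Q\<close> can be wasted, and
    \<open>gap\<close> bounds it.\<close>
  define U where "U = V - (C \<union> g ` T)"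
  have gQ: "g ` Q = f0 ` Q" using g(2) by simp
  have ginj: "inj_on g (Q \<union> T)" using g(1) unfolding emb_def by blast
  have cgT: "card (g ` T) = card T" using ginj by (meson card_image inj_on_subset sup_ge2)
  have "C \<union> g ` T = (C - f0 ` Q) \<union> (f0 ` Q \<union> g ` T)" using f0(2) by blast
  then have "card (C \<union> g ` T) \<le> card (C - f0 ` Q) + (card (f0 ` Q) + card (g ` T))"
    using card_Un_le[of "C - f0 ` Q" "f0 ` Q \<union> g ` T"] card_Un_le[of "f0 ` Q" "g ` T"] by simp
  also have "card (C - f0 ` Q) = card C - card Q" using f0(2) finQ cf0 by (simp add: card_Diff_subset)
  finally have cCT: "card (C \<union> g ` T) \<le> (card C - card Q) + card Q + card T" using cf0 cgT by simp
  have "C \<union> g ` T \<subseteq> V" using CV g(1) unfolding emb_def by blast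
  then have "card V = card U + card (C \<union> g ` T)"
    unfolding U_def using B.fin finC finT
    by (metis card_Diff_subset card_mono finite_UnI finite_imageI le_add_diff_inverse2)
  moreover have "card C - card Q \<le> card V - card VG"
    using gap cQ I'(2) by linarith
  ultimately have cU: "card (leaves_at v) \<le> card U" using cCT cT N_ge by linarith
  have "\<exists>h. emb A E V h ((Q \<union> T) \<union> leaves_at v) \<and> (\<forall>q\<in>Q \<union> T. h q = g q) \<and> h ` leaves_at v \<subseteq> U"
  proof (rule emb_greedy[where d = "card V"])
    show "A x y \<Longrightarrow> A y x" for x y by (rule G.sym)
    show "\<not> A x x" for x by (rule G.irrefl)
    show "E x y \<Longrightarrow> E y x" for x y by (rule B.sym)
    show "card (nbs E U w) \<le> card V" for w using B.fin unfolding U_def by (intro card_mono) auto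
    fix T' assume T': "T' \<subseteq> leaves_at v" "T' \<noteq> {}"
    then obtain x where x: "x \<in> T'" by blast
    have xl: "x \<in> G.leaves" "A v x" using x T' unfolding leaves_at_def by auto
    obtain y where y: "nbs A VG x = {y}" using G.leaf_neighbour[OF xl(1)] by blast
    have "v \<in> nbs A VG x" using v(1) G.sym[OF xl(2)] by simp
    then have nx: "nbs A VG x = {v}" using y by simp
    have vT: "v \<notin> leaves_at v" using G.irrefl unfolding leaves_at_def by simp
    have N0: "nbs A T' x = {}"
    proof (rule equals0I)
      fix z assume "z \<in> nbs A T' x"
      then have "z \<in> nbs A VG x" "z \<in> leaves_at v" using T' LvVG by auto
      then show False using nx vT by simp
    qed
    have F0: "{w \<in> U. \<exists>q\<in>Q \<union> T. A x q \<and> E (g q) w} = {}"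
    proof (rule equals0I)
      fix w assume "w \<in> {w \<in> U. \<exists>q\<in>Q \<union> T. A x q \<and> E (g q) w}"
      then obtain q where q: "w \<in> U" "q \<in> Q \<union> T" "A x q" "E (g q) w" by blast
      then have "q \<in> nbs A VG x" using QVG unfolding T_def by auto
      then have "q = v" using nx by simp
      then have "g q \<in> C" using g(2) f0(2) unfolding Q_def by auto
      then show False using P(3)[OF C, of "g q" w] q unfolding U_def by blast
    qed
    have cT': "card T' \<le> card (leaves_at v)" using T' Lvfin by (intro card_mono) auto
    show "\<exists>x\<in>T'. card T' + card {w \<in> U. \<exists>q\<in>Q \<union> T. A x q \<and> E (g q) w} + card (nbs A T' x) * card V \<le> card U"
      by (rule bexI[OF _ x], unfold N0 F0) (use cU cT' in simp)
  next
    show "U \<inter> g ` (Q \<union> T) = {}" using gQ f0(2) unfolding U_def by auto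
  qed (use g(1) Lvfin LvQ B.fin in \<open>auto simp: T_def U_def\<close>)
  moreover have "(Q \<union> T) \<union> leaves_at v = VG" using QVG LvVG unfolding T_def by blast
  ultimately show ?thesis by auto
qed

end

section \<open>Guests with few leaves\<close>

context packing begin

lemma mu_bound: "4 * int mu \<le> 5 * (int k * int k) + 2 * int k - 10"
proof -
  have "r \<le> (r + 1) * d" using mult_le_mono2[of 1 d "r + 1"] d_pos by simp
  then have "int mu = (int r + 1) * int d - int r" unfolding mu_def by (simp add: of_nat_diff algebra_simps)
  moreover have "(2 * (int r + 1)) * (2 * int d) \<le> (int k + 2) * (5 * int k - 6)"
    by (rule mult_mono) (use B.r_le nums in auto)
  then have "4 * ((int r + 1) * int d) \<le> 5 * (int k * int k) + 4 * int k - 12"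
    by (simp add: algebra_simps)
  moreover have "2 * int k - 2 \<le> 4 * int r" using B.k_le by linarith
  ultimately show ?thesis by linarith
qed

text \<open>Vertices of the guest at distance one or two. Vertices pairwise not \<open>near\<close>
  have no common neighbours, so each neighbour sees only one host vertex of large complement
  degree.\<close>

definition near :: "'a \<Rightarrow> 'a \<Rightarrow> bool" where
  "near x y \<longleftrightarrow> x \<in> VG \<and> y \<in> VG \<and> x \<noteq> y \<and> (A x y \<or> (\<exists>z\<in>VG. A x z \<and> A z y))"

lemma card_near:
  assumes x: "x \<in> G.path_like"
  shows "card {y \<in> G.path_like. near x y} \<le> 4"
proof -
  have xV: "x \<in> VG" and x2: "card (nbs A VG x) = 2"
    and y2: "\<And>y. y \<in> nbs A VG x \<Longrightarrow> card (nbs A VG y) = 2"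
    using x unfolding G.path_like_def G.dg_def by auto
  let ?K = "\<Union>z\<in>nbs A VG x. nbs A VG z - {x}"
  have "{y \<in> G.path_like. near x y} \<subseteq> nbs A VG x \<union> ?K"
    unfolding near_def nbs_def by blast
  then have "card {y \<in> G.path_like. near x y} \<le> card (nbs A VG x \<union> ?K)"
    using G.fin by (intro card_mono) auto
  also have "\<dots> \<le> 2 + card ?K" using card_Un_le[of "nbs A VG x" ?K] x2 by simp
  also have "card ?K \<le> (\<Sum>z\<in>nbs A VG x. card (nbs A VG z - {x}))" using G.fin by (intro card_UN_le) auto
  also have "\<dots> = (\<Sum>z\<in>nbs A VG x. 1)"
  proof (rule sum.cong)
    fix z assume z: "z \<in> nbs A VG x"
    then have "x \<in> nbs A VG z" using xV G.sym by auto
    then show "card (nbs A VG z - {x}) = 1" using y2[OF z] G.fin by simp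
  qed simp
  also have "\<dots> = 2" using x2 by simp
  finally show ?thesis by simp
qed

text \<open>Host vertices of large complement degree are spread over path-like vertices of the guest, whose
  neighbours have room to avoid them; those joined in the complement to about half of the host or
  more number fewer than \<open>r\<close> and are left unused. Every other host vertex misses most of a large
  independent set \<open>Z\<close> of guest vertices of degree two, so Hall's condition places \<open>Z\<close> last.\<close>

lemma embed_few_leaves:
  assumes few: "card G.leaves \<le> mu"
  shows "\<exists>h. emb A E V h VG"
proof -
  have n2: "2 \<le> card VG" using n_ge by simp
  have la: "4 * int (card G.leaves) \<le> 5 * (int k * int k) + 2 * int k - 10"
    using few mu_bound by linarith
  define X where "X = {w \<in> V. card V + k \<le> 2 * bdg w}"
  define H where "H = {w \<in> V. card VG \<le> 16 * bdg w} - X"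
  have cX: "card X < r" using B.card_very_high_degree unfolding X_def bdg_def .
  have finX: "finite X" and finH: "finite H" unfolding X_def H_def using B.fin by auto
  have HV: "H \<subseteq> V" unfolding H_def by auto
  have d16: "16 * d < card VG"
  proof -
    have "16 * int d < int (card VG)"
      using nums(1,2,6) KK(2)[OF numeric] by linarith
    then show ?thesis by simp
  qed
  have Hlow: "H \<inter> low = {}" using d16 unfolding H_def low_def by auto
  have cH: "int (card H) \<le> 9 * (int k - 2)"
  proof (rule few_high[OF numeric])
    \<comment> \<open>The ceiling of \<open>n / 16\<close>.\<close>
    define e where "e = (card VG + 15) div 16"
    have a: "2 * e * card H \<le> (k - 2) * (card V + card H)"
      by (rule B.card_high_degree) (auto simp: H_def bdg_def e_def)
    have "card VG \<le> 16 * e" unfolding e_def by simp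
    then have "card VG * card H \<le> 16 * e * card H" by (rule mult_le_mono1)
    also have "\<dots> = 8 * (2 * e * card H)" by simp
    also have "\<dots> \<le> 8 * ((k - 2) * (card V + card H))" using a by (rule mult_le_mono2)
    finally have "card H * card VG \<le> 8 * ((k - 2) * (card V + card H))" by (simp only: mult.commute)
    then have "int (card H * card VG) \<le> int (8 * ((k - 2) * (card V + card H)))" by (rule zle_int[THEN iffD2])
    moreover have k2: "int (k - 2) = int k - 2" using B.k2 by simp
    have "int (8 * ((k - 2) * (card V + card H))) = 8 * ((int k - 2) * (int (card V) + int (card H)))"
      unfolding of_nat_mult of_nat_add k2 by simp
    ultimately show "int (card H) * int (card VG) \<le> 8 * ((int k - 2) * (int (card V) + int (card H)))"
      by (metis of_nat_mult)
  qed
  have finPL: "finite G.path_like" and PLV: "G.path_like \<subseteq> VG" unfolding G.path_like_def using G.fin by auto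
  have "\<exists>I\<subseteq>G.path_like. (\<forall>x\<in>I. \<forall>y\<in>I. x \<noteq> y \<longrightarrow> \<not> near x y) \<and> card G.path_like \<le> (4 + 1) * card I"
  proof (rule conflict_free_subset[OF finPL card_near])
    show "near x y \<Longrightarrow> near y x" for x y unfolding near_def using G.sym by blast
  qed
  then obtain Y0 where Y0: "Y0 \<subseteq> G.path_like" "\<forall>x\<in>Y0. \<forall>y\<in>Y0. x \<noteq> y \<longrightarrow> \<not> near x y"
    "card G.path_like \<le> 5 * card Y0" by auto
  have "45 * (int k - 2) \<le> 5 * int (card Y0)"
    using many_path_like[OF numeric la] G.card_path_like[OF n2] Y0(3) by linarith
  then have "card H \<le> card Y0" using cH by linarith
  then obtain Y where Y: "Y \<subseteq> Y0" "card Y = card H" using obtain_subset_with_card_n by metis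
  have YPL: "Y \<subseteq> G.path_like" using Y Y0 by blast
  have YV: "Y \<subseteq> VG" using YPL PLV by blast
  have finY: "finite Y" using YV G.finite_sub by blast
  have Ynear: "\<not> near x y" if "x \<in> Y" "y \<in> Y" for x y
    using that Y(1) Y0(2) unfolding near_def by blast
  have Yadj: "\<not> A x y" if "x \<in> Y" "y \<in> Y" for x y
    using Ynear[OF that] that YV G.irrefl unfolding near_def by blast
  obtain f0 where f0: "bij_betw f0 Y H" using finite_same_card_bij[OF finY finH Y(2)] by blast
  have emb0: "emb A E V f0 Y" using f0 HV Yadj unfolding emb_def bij_betw_def by blast
  \<comment> \<open>The neighbours of \<open>Y\<close> follow directly, while nearly all low
    vertices are free, since about half of the host may be blocked for each of them.\<close>
  define M where "M = (\<Union>y\<in>Y. nbs A VG y)"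
  have MV: "M \<subseteq> VG" unfolding M_def by auto
  have finM: "finite M" using MV G.finite_sub by blast
  have YM: "Y \<inter> M = {}" unfolding M_def using Yadj by auto
  have Y2: "card (nbs A VG y) = 2" if "y \<in> Y" for y
    using that YPL unfolding G.path_like_def G.dg_def by auto
  have M2: "G.dg x = 2" if "x \<in> M" for x using that YPL unfolding M_def G.path_like_def by auto
  \<comment> \<open>Hence a vertex with three or more neighbours in the rest has none in
    \<open>M\<close>, as the exceptional case of \<open>embed_rest\<close> will require.\<close>
  have MM2: "G.dg x = 2" if xq: "x \<in> VG" "q \<in> M" "A x q" for x q
  proof -
    obtain y where y: "y \<in> Y" "q \<in> nbs A VG y" using xq(2) unfolding M_def by blast
    have "x \<in> nbs A VG q" using xq G.sym by auto
    then show ?thesis using y YPL unfolding G.path_like_def by blast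
  qed
  have "card M \<le> (\<Sum>y\<in>Y. card (nbs A VG y))" unfolding M_def using finY by (rule card_UN_le)
  also have "\<dots> = 2 * card Y" using Y2 by simp
  finally have cM: "card M \<le> 2 * card Y" .
  have "\<exists>g. emb A E V g (Y \<union> M) \<and> (\<forall>q\<in>Y. g q = f0 q) \<and> g ` M \<subseteq> low"
  proof (rule emb_greedy[where d = d])
    show "A x y \<Longrightarrow> A y x" for x y by (rule G.sym)
    show "\<not> A x x" for x by (rule G.irrefl)
    show "E x y \<Longrightarrow> E y x" for x y by (rule B.sym)
    show "card (nbs E low w) \<le> d" if "w \<in> low" for w
      using that card_nbs_mono[OF B.fin low_subset, of E w] unfolding low_def bdg_def by simp
    show "low \<inter> f0 ` Y = {}" using f0 Hlow unfolding bij_betw_def by blast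
    fix T' assume T': "T' \<subseteq> M" "T' \<noteq> {}"
    then obtain x where x: "x \<in> T'" by blast
    then have xM: "x \<in> M" using T' by blast
    let ?F = "{w \<in> low. \<exists>q\<in>Y. A x q \<and> E (f0 q) w}"
    have F: "2 * card ?F \<le> card V + k"
    proof -
      obtain y where y: "y \<in> Y" "A y x" using xM unfolding M_def by auto
      have "q = y" if "q \<in> Y" "A x q" for q
        using Ynear[OF y(1) that(1)] y that YV xM MV unfolding near_def by blast
      then have "?F \<subseteq> nbs E V (f0 y)" using low_subset by auto
      then have "card ?F \<le> bdg (f0 y)" unfolding bdg_def using B.fin by (intro card_mono) auto
      moreover have "f0 y \<in> H" using f0 y unfolding bij_betw_def by blast
      ultimately show ?thesis unfolding H_def X_def by auto
    qed
    have "T' \<subseteq> VG" using T' MV by blast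
    then have "card (nbs A T' x) \<le> G.dg x"
      unfolding G.dg_def using G.fin by (rule card_nbs_mono[rotated])
    then have "card (nbs A T' x) * d \<le> 2 * d" using M2[OF xM] by simp
    moreover have "card T' \<le> card M" using T' finM by (intro card_mono) auto
    ultimately have "card T' + card ?F + card (nbs A T' x) * d \<le> card low"
      using neighbour_stage_bound[OF numeric] F cM Y(2) cH card_low by linarith
    then show "\<exists>x\<in>T'. card T' + card {w \<in> low. \<exists>q\<in>Y. A x q \<and> E (f0 q) w} + card (nbs A T' x) * d \<le> card low"
      using x by blast
  qed (use emb0 finM YM finite_low low_subset in auto)
  then obtain f1 where f1: "emb A E V f1 (Y \<union> M)" "\<And>q. q \<in> Y \<Longrightarrow> f1 q = f0 q" "f1 ` M \<subseteq> low" by blast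
  have f1Y: "f1 ` Y = H" using f1(2) f0 unfolding bij_betw_def by auto
  define T2 where "T2 = {x \<in> VG. G.dg x = 2} - (Y \<union> M)"
  have finT2: "finite T2" unfolding T2_def using G.fin by simp
  have "\<exists>I\<subseteq>T2. (\<forall>x\<in>I. \<forall>y\<in>I. x \<noteq> y \<longrightarrow> \<not> A x y) \<and> card T2 \<le> (2 + 1) * card I"
  proof (rule conflict_free_subset[OF finT2])
    fix x assume x: "x \<in> T2"
    have "{y \<in> T2. A x y} \<subseteq> nbs A VG x" unfolding T2_def by auto
    then have "card {y \<in> T2. A x y} \<le> G.dg x" unfolding G.dg_def using G.fin by (intro card_mono) auto
    then show "card {y \<in> T2. A x y} \<le> 2" using x unfolding T2_def by simp
  qed (rule G.sym)
  then obtain Z where Z: "Z \<subseteq> T2" "\<forall>x\<in>Z. \<forall>y\<in>Z. x \<noteq> y \<longrightarrow> \<not> A x y" "card T2 \<le> 3 * card Z" by auto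
  have ZV: "Z \<subseteq> VG" "Z \<inter> (Y \<union> M) = {}" using Z(1) unfolding T2_def by auto
  have finZ: "finite Z" using ZV G.finite_sub by blast
  have Zadj: "\<not> A x y" if "x \<in> Z" "y \<in> Z" for x y using Z(2) that G.irrefl by metis
  have cZ: "int (card VG) \<le> 2 * int (card G.leaves) + 2 * l + 3 * int (card Y) + 3 * int (card Z)"
  proof -
    have "VG \<subseteq> {x \<in> VG. G.dg x \<noteq> 2} \<union> (Y \<union> (M \<union> T2))" unfolding T2_def by blast
    then have "card VG \<le> card ({x \<in> VG. G.dg x \<noteq> 2} \<union> (Y \<union> (M \<union> T2)))"
      using G.fin finY finM finT2 by (intro card_mono) auto
    also have "\<dots> \<le> card {x \<in> VG. G.dg x \<noteq> 2} + (card Y + (card M + card T2))"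
      by (meson add_le_mono card_Un_le le_trans order_refl)
    finally show ?thesis using G.card_not_two[OF n2] cM Z(3) by linarith
  qed
  define T where "T = VG - Y - M - Z"
  have finT: "finite T" unfolding T_def using G.fin by simp
  have "card VG = card (T \<union> (Y \<union> (M \<union> Z)))"
    using YV MV ZV unfolding T_def by (intro arg_cong[of _ _ card]) auto
  also have "\<dots> = card T + (card Y + (card M + card Z))"
    using finT finY finM finZ YM ZV unfolding T_def
    by (subst card_Un_disjoint, force, force, force)+ simp
  finally have cT: "card VG = card T + card Y + card M + card Z" by simp
  define L where "L = low - f1 ` M"
  have f1inj: "inj_on f1 (Y \<union> M)" using f1(1) unfolding emb_def by blast
  have "card (f1 ` M) = card M" using f1inj by (meson card_image inj_on_subset sup_ge2)
  then have cL: "card low = card L + card M"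
    unfolding L_def using f1(3) finite_low finM
    by (metis card_Diff_subset card_mono finite_imageI le_add_diff_inverse2)
  have "\<exists>g. emb A E V g ((Y \<union> M) \<union> T) \<and> (\<forall>q\<in>Y \<union> M. g q = f1 q) \<and> g ` T \<subseteq> L"
  proof (rule embed_rest[where e = d])
    show "L \<inter> f1 ` (Y \<union> M) = {}" using f1Y Hlow unfolding L_def by (auto simp: image_Un)
    fix x T' assume T': "T' \<subseteq> T" "x \<in> T'"
    then have xT: "x \<in> T" by blast
    have xV: "x \<in> VG" using xT unfolding T_def by blast
    have nb: "nbs A (Y \<union> M) x = nbs A M x"
    proof -
      have "\<not> A x y" if "y \<in> Y" for y
        using xT that G.sym unfolding T_def M_def nbs_def by blast
      then show ?thesis by auto
    qed
    let ?F = "{w \<in> L. \<exists>q\<in>Y \<union> M. A x q \<and> E (f1 q) w}"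
    have "card ?F \<le> (\<Sum>q\<in>nbs A (Y \<union> M) x. bdg (f1 q))"
      using finY finM low_subset unfolding L_def by (intro blocked_subset) auto
    also have "\<dots> \<le> card (nbs A M x) * d"
      unfolding nb using sum_bounded_above[of "nbs A M x" "\<lambda>q. bdg (f1 q)" d] f1(3) unfolding low_def by auto
    finally have F: "card ?F \<le> card (nbs A M x) * d" .
    have tot: "card (nbs A M x) + card (nbs A T' x) \<le> G.dg x"
    proof -
      have "card (nbs A M x) + card (nbs A T' x) = card (nbs A M x \<union> nbs A T' x)"
        using finM finT T' finite_subset[of T' T] by (intro card_Un_disjoint[symmetric]) (auto simp: T_def)
      also have "\<dots> \<le> G.dg x"
        unfolding G.dg_def
      proof (rule card_mono)
        show "nbs A M x \<union> nbs A T' x \<subseteq> nbs A VG x" using MV T'(1) unfolding T_def by auto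
      qed (simp add: G.fin)
      finally show ?thesis .
    qed
    have dg2: "G.dg x = 2" if "nbs A M x \<noteq> {}" using that MM2[OF xV] by auto
    { assume a: "card (nbs A T' x) \<le> 2"
      have "card (nbs A M x) + card (nbs A T' x) \<le> 2"
      proof (cases "nbs A M x = {}")
        case True
        then show ?thesis using a by simp
      next
        case False
        then show ?thesis using tot dg2 by simp
      qed
      then have "(card (nbs A M x) + card (nbs A T' x)) * d \<le> 2 * d" by (rule mult_le_mono1)
      then have "card ?F + card (nbs A T' x) * d \<le> 2 * d" using F by (simp add: add_mult_distrib)
      then show "card T + card ?F + card (nbs A T' x) * d \<le> card L"
        using stage_one_bound[OF numeric la] cT cL card_low cZ N_ge by linarith }
    { assume "3 \<le> card (nbs A T' x)"
      then have "nbs A M x = {}" using tot dg2 by fastforce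
      then show "card ?F \<le> k" using F by simp }
  next
    show "card V \<le> card L + card (V - low) + 19 * k"
    proof -
      have "card H \<le> 9 * k" using cH by simp
      then show ?thesis using cL card_low cM Y(2) by linarith
    qed
  qed (use f1(1) low_subset in \<open>auto simp: T_def L_def low_def\<close>)
  then obtain g where g: "emb A E V g ((Y \<union> M) \<union> T)" "\<And>q. q \<in> Y \<union> M \<Longrightarrow> g q = f1 q" "g ` T \<subseteq> L" by blast
  define S where "S = (Y \<union> M) \<union> T"
  have SV: "S = VG - Z" using YV MV ZV unfolding S_def T_def by blast
  have gS: "emb A E V g S" using g(1) unfolding S_def .
  have finS: "finite S" unfolding S_def using finY finM finT by simp
  have glow: "bdg (g q) \<le> d" if "q \<in> S" "q \<notin> Y" for q
    using that g(2,3) f1(3) unfolding S_def L_def low_def by fastforce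
  \<comment> \<open>Dropping \<open>X\<close> costs at most \<open>r - 1\<close> vertices, and the
    host has that many to spare.\<close>
  define U where "U = V - X - g ` S"
  have finU: "finite U" unfolding U_def using B.fin by simp
  have cS: "card (g ` S) = card S" using gS unfolding emb_def by (simp add: card_image)
  have "card VG = card S + card Z" using SV ZV G.fin finZ
    by (metis card_Diff_subset card_mono le_add_diff_inverse2)
  moreover have "V \<subseteq> U \<union> (X \<union> g ` S)" unfolding U_def by blast
  then have "card V \<le> card (U \<union> (X \<union> g ` S))" using finU finX finS by (intro card_mono) auto
  then have "card V \<le> card U + (card X + card S)"
    using card_Un_le[of U "X \<union> g ` S"] card_Un_le[of X "g ` S"] cS by linarith
  ultimately have cU: "card Z \<le> card U" using cX N_lower by linarith
  have "\<exists>h. emb A E V h (S \<union> Z) \<and> (\<forall>s\<in>S. h s = g s) \<and> h ` Z \<subseteq> U"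
  proof (rule emb_hall)
    show "A x y \<Longrightarrow> A y x" for x y by (rule G.sym)
    show "E x y \<Longrightarrow> E y x" for x y by (rule B.sym)
    fix J assume J: "J \<subseteq> Z" "J \<noteq> {}"
    define al where "al = {u \<in> U. \<exists>z\<in>J. \<forall>y\<in>S. A z y \<longrightarrow> \<not> E (g y) u}"
    have "card J \<le> card al"
    proof (rule ccontr)
      assume v: "\<not> card J \<le> card al"
      have finJ: "finite J" using J finZ finite_subset by blast
      have cJ: "card J \<le> card Z" using J finZ by (intro card_mono) auto
      have alU: "al \<subseteq> U" unfolding al_def by auto
      \<comment> \<open>First estimate: \<open>z\<close> has two neighbours, both with images of
        degree at most \<open>d\<close>, so at most \<open>2 * d\<close> free vertices are not
        candidates and \<open>J\<close> is nearly all of \<open>Z\<close>.\<close>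
      obtain z where z: "z \<in> J" using J by blast
      have zV: "z \<in> VG" "G.dg z = 2" "z \<notin> M" using z J(1) Z(1) unfolding T2_def by auto
      have "U - al \<subseteq> (\<Union>q\<in>nbs A S z. nbs E V (g q))"
      proof
        fix u assume u: "u \<in> U - al"
        then obtain q where "q \<in> S" "A z q" "E (g q) u" using z unfolding al_def by blast
        moreover have "u \<in> V" using u unfolding U_def by blast
        ultimately have "q \<in> nbs A S z" "u \<in> nbs E V (g q)" by auto
        then show "u \<in> (\<Union>q\<in>nbs A S z. nbs E V (g q))" by blast
      qed
      then have "card (U - al) \<le> card (\<Union>q\<in>nbs A S z. nbs E V (g q))"
        using finS B.fin by (intro card_mono) auto
      also have "\<dots> \<le> (\<Sum>q\<in>nbs A S z. bdg (g q))"
        unfolding bdg_def using finS by (intro card_UN_le) auto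
      also have "\<dots> \<le> card (nbs A S z) * d"
      proof -
        have "bdg (g q) \<le> d" if "q \<in> nbs A S z" for q
        proof (rule glow)
          show "q \<notin> Y"
            using that zV G.sym unfolding M_def nbs_def by blast
        qed (use that in auto)
        then show ?thesis using sum_bounded_above[of "nbs A S z" "\<lambda>q. bdg (g q)" d] by auto
      qed
      also have "\<dots> \<le> 2 * d"
      proof (rule mult_le_mono1)
        have "card (nbs A S z) \<le> G.dg z"
          unfolding G.dg_def using SV G.fin by (intro card_mono) auto
        then show "card (nbs A S z) \<le> 2" using zV by simp
      qed
      finally have "card (U - al) \<le> 2 * d" .
      moreover have "card U = card al + card (U - al)"
        using alU finU by (metis card_Diff_subset card_mono finite_subset le_add_diff_inverse)
      ultimately have 1: "card Z + 1 \<le> card J + 2 * d" using cU v by linarith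
      \<comment> \<open>Second estimate: take a free vertex \<open>u\<close> that is no candidate
        for any member of \<open>J\<close>. Fewer than \<open>n / 16\<close> guest vertices sit on
        its complement neighbours, yet their neighbourhoods cover \<open>J\<close>.\<close>
      have "card al < card U" using v cJ cU by linarith
      then have "\<not> U \<subseteq> al" using alU by auto
      then obtain u where u: "u \<in> U" "u \<notin> al" by blast
      \<comment> \<open>All of \<open>H\<close> is occupied by the images of
        \<open>Y\<close>.\<close>
      have "u \<notin> H" using u(1) f1Y g(2) unfolding U_def S_def by (auto simp: image_Un)
      then have ub: "16 * bdg u < card VG" using u(1) unfolding U_def H_def by auto
      define W where "W = {q \<in> S. E (g q) u}"
      have WS: "W \<subseteq> S" unfolding W_def by auto
      have "g ` W \<subseteq> nbs E V u" using gS B.sym unfolding W_def emb_def by auto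
      then have "card (g ` W) \<le> bdg u" unfolding bdg_def using B.fin by (intro card_mono) auto
      moreover have "card (g ` W) = card W" using gS WS unfolding emb_def by (meson card_image inj_on_subset)
      ultimately have cW: "16 * card W < card VG" using ub by linarith
      have WV: "W \<subseteq> VG" using WS SV by blast
      have "J \<subseteq> (\<Union>q\<in>W. nbs A VG q)"
      proof
        fix z assume z: "z \<in> J"
        then obtain q where "q \<in> S" "A z q" "E (g q) u" using u unfolding al_def by blast
        then have "q \<in> W" "z \<in> nbs A VG q" using z J(1) ZV(1) G.sym unfolding W_def by auto
        then show "z \<in> (\<Union>q\<in>W. nbs A VG q)" by blast
      qed
      then have "card J \<le> card (\<Union>q\<in>W. nbs A VG q)" using WV G.fin G.finite_sub by (intro card_mono) auto
      also have "\<dots> \<le> (\<Sum>q\<in>W. G.dg q)"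
        unfolding G.dg_def using WV G.finite_sub by (intro card_UN_le) auto
      finally have "int (card J) \<le> 2 * int (card W) + int (card G.leaves) + 2 * l"
        using G.sum_dg_bound[OF n2 WV] by linarith
      moreover have "6 * int (card W) + 5 * int (card G.leaves) + 8 * l + 6 * int d + 3 * int (card Y) \<le> int (card VG)"
        by (rule cover_bound[OF numeric la]) (use cW cH Y(2) in auto)
      ultimately show False using 1 cZ by linarith
    qed
    then show "card J \<le> card {u \<in> U. \<exists>z\<in>J. \<forall>y\<in>S. A z y \<longrightarrow> \<not> E (g y) u}" unfolding al_def .
  qed (use gS finZ finU Zadj SV in \<open>auto simp: U_def\<close>)
  moreover have "S \<union> Z = VG" using SV ZV by blast
  ultimately show ?thesis by auto
qed

text \<open>The hub is not known in advance, so an independent set is requested at every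
  vertex.\<close>

lemma embed_guest:
  assumes "\<And>v. v \<in> VG \<Longrightarrow> \<exists>I\<subseteq>VG. v \<notin> I \<and> (\<forall>x\<in>I. \<not> A v x) \<and> (\<forall>x\<in>I. \<forall>y\<in>I. \<not> A x y) \<and>
    (card VG + k \<le> card V + card I + 2 \<or> (card VG + k \<le> card V + card I + 3 \<and> \<not> (k - 1) dvd card V))"
  shows "\<exists>h. emb A E V h VG"
proof (cases "mu < card G.leaves")
  case False
  then show ?thesis using embed_few_leaves by simp
next
  case leaves: True
  show ?thesis
  proof (cases "\<exists>v\<in>VG. d < card (leaves_at v)")
    case False
    then show ?thesis using embed_spread_leaves[OF leaves] by (meson not_le)
  next
    case True
    then obtain v where v: "v \<in> VG" "d < card (leaves_at v)" by blast
    show ?thesis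
    proof (cases "\<exists>p\<in>V. bdg p < r")
      case True
      then show ?thesis using embed_hub_at_low_vertex[OF leaves v] by blast
    next
      case False
      then have deg: "\<And>w. w \<in> V \<Longrightarrow> r \<le> bdg w" by (meson not_le)
      obtain I where I: "I \<subseteq> VG" "v \<notin> I" "\<forall>x\<in>I. \<not> A v x" "\<forall>x\<in>I. \<forall>y\<in>I. \<not> A x y"
        "card VG + k \<le> card V + card I + 2 \<or> (card VG + k \<le> card V + card I + 3 \<and> \<not> (k - 1) dvd card V)"
        using assms[OF v(1)] by blast
      show ?thesis by (rule embed_hub_in_component[OF v deg I(1,2) _ _ I(5)]) (use I(3,4) in auto)
    qed
  qed
qed

end

section \<open>Ramsey numbers\<close>

definition adj :: "'a ugraph \<Rightarrow> 'a \<Rightarrow> 'a \<Rightarrow> bool" where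
  "adj G x y \<longleftrightarrow> {x, y} \<in> edges G"

lemma simple_graph_adjD:
  assumes "simple_graph G" "adj G x y"
  shows "x \<in> verts G" "y \<in> verts G" "x \<noteq> y"
proof -
  have "{x, y} \<in> [verts G]\<^bsup>2\<^esup>" using assms unfolding simple_graph_def adj_def by blast
  then show "x \<in> verts G" "y \<in> verts G" "x \<noteq> y" unfolding doubleton_in_nsets_2 by simp_all
qed

lemma adj_sym: "adj G x y \<Longrightarrow> adj G y x"
  unfolding adj_def by (simp add: insert_commute)

lemma simple_graph_edgeE:
  assumes "simple_graph G" "e \<in> edges G"
  obtains x y where "e = {x, y}" "adj G x y"
proof -
  have "e \<in> [verts G]\<^bsup>2\<^esup>" using assms unfolding simple_graph_def by blast
  then obtain x y where "e = {x, y}" unfolding nsets_def by (auto simp: card_2_iff)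
  then show ?thesis using assms(2) that unfolding adj_def by blast
qed

lemma simple_complement: "simple_graph G \<Longrightarrow> simple_graph (complement_graph G)"
  unfolding simple_graph_def complement_graph_def by auto

lemma adj_complement:
  "adj (complement_graph G) x y \<longleftrightarrow> x \<in> verts G \<and> y \<in> verts G \<and> x \<noteq> y \<and> \<not> adj G x y"
  unfolding adj_def complement_graph_def by (auto simp: doubleton_in_nsets_2)

lemma verts_complement [simp]: "verts (complement_graph G) = verts G"
  unfolding complement_graph_def by simp

lemma fin_graph_adj: "simple_graph G \<Longrightarrow> fin_graph (verts G) (adj G)"
  using simple_graph_adjD adj_sym unfolding fin_graph_def simple_graph_def by metis

text \<open>The handshake identity, by double counting incident pairs.\<close>

lemma degsum_edges:
  assumes G: "simple_graph G"
  shows "degsum (adj G) (verts G) = 2 * card (edges G)"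
proof -
  have finV: "finite (verts G)" and sub: "edges G \<subseteq> [verts G]\<^bsup>2\<^esup>" using G unfolding simple_graph_def by auto
  have finE: "finite (edges G)" using sub finV finite_imp_finite_nsets finite_subset by metis
  have "card (nbs (adj G) (verts G) x) = card {e \<in> edges G. x \<in> e}" for x
  proof (rule bij_betw_same_card[of "\<lambda>y. {x, y}"], rule bij_betw_imageI)
    show "inj_on (\<lambda>y. {x, y}) (nbs (adj G) (verts G) x)"
      by (auto simp: inj_on_def doubleton_eq_iff)
    show "(\<lambda>y. {x, y}) ` nbs (adj G) (verts G) x = {e \<in> edges G. x \<in> e}"
    proof (intro equalityI subsetI)
      fix e assume e: "e \<in> {e \<in> edges G. x \<in> e}"
      then obtain u w where uw: "e = {u, w}" "adj G u w" using simple_graph_edgeE[OF G] by blast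
      have "u \<in> verts G" "w \<in> verts G" using simple_graph_adjD[OF G uw(2)] by auto
      then show "e \<in> (\<lambda>y. {x, y}) ` nbs (adj G) (verts G) x"
        using e uw adj_sym[OF uw(2)] by (auto simp: insert_commute)
    qed (auto simp: adj_def)
  qed
  then have "degsum (adj G) (verts G) = (\<Sum>x\<in>verts G. \<Sum>e\<in>edges G. if x \<in> e then 1 else 0)"
    unfolding degsum_def using finE by (simp add: sum.If_cases Int_def)
  also have "\<dots> = (\<Sum>e\<in>edges G. \<Sum>x\<in>verts G. if x \<in> e then 1 else 0)" by (rule sum.swap)
  also have "\<dots> = (\<Sum>e\<in>edges G. 2)"
  proof (rule sum.cong)
    fix e assume "e \<in> edges G"
    then have e: "e \<subseteq> verts G" "card e = 2" using sub unfolding nsets_def by auto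
    have "(\<Sum>x\<in>verts G. if x \<in> e then 1 else 0) = card (verts G \<inter> e)"
      using finV by (simp add: sum.If_cases)
    also have "verts G \<inter> e = e" using e by blast
    finally show "(\<Sum>x\<in>verts G. if x \<in> e then 1 else 0) = (2::nat)" using e by simp
  qed simp
  finally show ?thesis by simp
qed

lemma connected_crossing_edge:
  assumes G: "simple_graph G" "connected_graph G" and T: "T \<subseteq> verts G" "T \<noteq> {}" "T \<noteq> verts G"
  shows "\<exists>x\<in>T. \<exists>y\<in>verts G - T. adj G x y"
proof (rule ccontr)
  assume n: "\<not> ?thesis"
  obtain u v where uv: "u \<in> T" "v \<in> verts G - T" using T by blast
  have "(u, v) \<in> {(x, y). {x, y} \<in> edges G}\<^sup>*" using G(2) T(1) uv unfolding connected_graph_def by blast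
  then have "v \<in> T"
  proof (induction rule: rtrancl_induct)
    case base
    show ?case by (rule uv(1))
  next
    case (step y z)
    then have "adj G y z" unfolding adj_def by simp
    moreover have "z \<in> verts G" using simple_graph_adjD(2)[OF G(1)] calculation .
    ultimately show ?case using n step.IH by blast
  qed
  then show False using uv by simp
qed

lemma sparse_graph_adj:
  assumes "simple_graph G" "connected_graph G"
  shows "sparse_graph (verts G) (adj G) (int (card (edges G)) - int (card (verts G)))"
  unfolding sparse_graph_def sparse_graph_axioms_def
  using fin_graph_adj[OF assms(1)] connected_crossing_edge[OF assms] degsum_edges[OF assms(1)] by auto

lemma path_free_complement:
  assumes G: "simple_graph G" "\<not> contains_graph (complement_graph G) (path_graph k)" and k: "2 \<le> k"
  shows "path_free (verts G) (adj (complement_graph G)) k (k div 2)"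
proof -
  have "length xs \<noteq> k" if p: "gpath (adj (complement_graph G)) (verts G) xs" for xs
  proof
    assume len: "length xs = k"
    have "contains_graph (complement_graph G) (path_graph k)"
      unfolding contains_graph_def
    proof (intro exI[of _ "\<lambda>i. xs ! i"] conjI ballI)
      show "inj_on ((!) xs) (verts (path_graph k))"
        using p len unfolding gpath_def path_graph_def by (auto simp: inj_on_def nth_eq_iff_index_eq)
      show "(!) xs ` verts (path_graph k) \<subseteq> verts (complement_graph G)"
        using p len unfolding gpath_def path_graph_def by auto
      fix e assume "e \<in> edges (path_graph k)"
      then obtain i where i: "e = {i, Suc i}" "Suc i < k" unfolding path_graph_def by auto
      have "adj (complement_graph G) (xs ! i) (xs ! Suc i)"
        using p i(2) len unfolding gpath_def by (simp add: successively_conv_nth)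
      then show "(!) xs ` e \<in> edges (complement_graph G)" unfolding i(1) adj_def by simp
    qed
    then show False using G(2) by simp
  qed
  then show ?thesis
    unfolding path_free_def path_free_axioms_def
    using fin_graph_adj[OF simple_complement[OF G(1)]] k by auto
qed

section \<open>Independence numbers and \<open>alpha'\<close>\<close>

lemma finite_indep_cards: "finite (verts G) \<Longrightarrow> finite {card S | S. S \<subseteq> verts G \<and> indep S (edges G)}"
proof -
  assume f: "finite (verts G)"
  have "{card S | S. S \<subseteq> verts G \<and> indep S (edges G)} \<subseteq> card ` Pow (verts G)" by auto
  then show ?thesis using f finite_subset by blast
qed

lemma independence_number_ge:
  assumes "finite (verts G)" "S \<subseteq> verts G" "indep S (edges G)"
  shows "card S \<le> independence_number G"
  unfolding independence_number_def using finite_indep_cards[OF assms(1)] assms(2,3)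
  by (intro Max_ge) auto

lemma independence_number_attained:
  assumes "finite (verts G)"
  obtains S where "S \<subseteq> verts G" "indep S (edges G)" "card S = independence_number G"
proof -
  let ?K = "{card S | S. S \<subseteq> verts G \<and> indep S (edges G)}"
  have "indep {} (edges G)" unfolding indep_def by simp
  then have "card {} \<in> ?K" by (intro CollectI exI[of _ "{}"]) auto
  then have "Max ?K \<in> ?K" using finite_indep_cards[OF assms] by (intro Max_in) auto
  then obtain S where "Max ?K = card S" "S \<subseteq> verts G \<and> indep S (edges G)" by auto
  then show ?thesis using that[of S] unfolding independence_number_def by simp
qed

lemma alpha'_le:
  assumes "finite (verts G)" "v \<in> verts G"
  shows "alpha' G \<le> independence_number (delete_closed_nbhd G v)"
  unfolding alpha'_def using assms by (intro Min_le) auto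

lemma alpha'_attained:
  assumes "finite (verts G)" "verts G \<noteq> {}"
  obtains v where "v \<in> verts G" "alpha' G = independence_number (delete_closed_nbhd G v)"
proof -
  have "alpha' G \<in> (\<lambda>v. independence_number (delete_closed_nbhd G v)) ` verts G"
    unfolding alpha'_def using assms by (intro Min_in) auto
  then show ?thesis using that by auto
qed

lemma verts_delete: "verts (delete_closed_nbhd G v) = {x \<in> verts G. x \<noteq> v \<and> \<not> adj G v x}"
  unfolding delete_closed_nbhd_def induced_subgraph_def neighbors_def adj_def by auto

lemma edges_delete:
  "x \<in> verts (delete_closed_nbhd G v) \<Longrightarrow> y \<in> verts (delete_closed_nbhd G v) \<Longrightarrow>
    {x, y} \<in> edges (delete_closed_nbhd G v) \<longleftrightarrow> adj G x y"
  unfolding delete_closed_nbhd_def induced_subgraph_def neighbors_def adj_def by auto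

definition ramsey_prop :: "'a ugraph \<Rightarrow> 'b ugraph \<Rightarrow> nat \<Rightarrow> bool" where
  "ramsey_prop H1 H2 N \<longleftrightarrow> (\<forall>\<Gamma> :: nat ugraph. simple_graph \<Gamma> \<and> card (verts \<Gamma>) = N \<longrightarrow>
     contains_graph \<Gamma> H1 \<or> contains_graph (complement_graph \<Gamma>) H2)"

lemma contains_graph_mono:
  "contains_graph G H \<Longrightarrow> verts G \<subseteq> verts G' \<Longrightarrow> edges G \<subseteq> edges G' \<Longrightarrow> contains_graph G' H"
  unfolding contains_graph_def by (meson order_trans subsetD)

text \<open>Restrict a larger host to \<open>N\<close> vertices. Thanks to this, one bad host of
  order \<open>L\<close> excludes every order up to \<open>L\<close>.\<close>

lemma ramsey_prop_mono:
  assumes "ramsey_prop H1 H2 N" "N \<le> M"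
  shows "ramsey_prop H1 H2 M"
  unfolding ramsey_prop_def
proof (intro allI impI)
  fix \<Gamma> :: "nat ugraph" assume G: "simple_graph \<Gamma> \<and> card (verts \<Gamma>) = M"
  obtain W where W: "W \<subseteq> verts \<Gamma>" "card W = N"
    using obtain_subset_with_card_n[of N "verts \<Gamma>"] G assms(2) by metis
  let ?H = "induced_subgraph \<Gamma> W"
  have vW: "verts ?H = W" using W unfolding induced_subgraph_def by auto
  have "simple_graph ?H"
    using G W finite_subset[of W "verts \<Gamma>"] unfolding simple_graph_def induced_subgraph_def nsets_def by auto
  then have "contains_graph ?H H1 \<or> contains_graph (complement_graph ?H) H2"
    using assms(1)[unfolded ramsey_prop_def, THEN spec, of ?H] vW W(2) by simp
  moreover have "edges ?H \<subseteq> edges \<Gamma>" unfolding induced_subgraph_def by auto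
  moreover have "edges (complement_graph ?H) \<subseteq> edges (complement_graph \<Gamma>)"
    using W unfolding complement_graph_def induced_subgraph_def nsets_def by auto
  ultimately show "contains_graph \<Gamma> H1 \<or> contains_graph (complement_graph \<Gamma>) H2"
    using contains_graph_mono vW W(1) by (metis verts_complement)
qed

section \<open>Hosts for the lower bounds\<close>

definition class_graph :: "nat \<Rightarrow> (nat \<Rightarrow> nat \<Rightarrow> bool) \<Rightarrow> nat ugraph" where
  "class_graph N R = \<lparr>verts = {..<N}, edges = {{i, j} | i j. i < N \<and> j < N \<and> i \<noteq> j \<and> R i j}\<rparr>"

lemma class_graph_props:
  assumes "\<And>i j. R i j \<Longrightarrow> R j i"
  shows "verts (class_graph N R) = {..<N}" "simple_graph (class_graph N R)"
    "adj (class_graph N R) i j \<longleftrightarrow> i < N \<and> j < N \<and> i \<noteq> j \<and> R i j"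
proof -
  show "simple_graph (class_graph N R)"
    unfolding simple_graph_def class_graph_def by (auto simp: doubleton_in_nsets_2)
  show "adj (class_graph N R) i j \<longleftrightarrow> i < N \<and> j < N \<and> i \<noteq> j \<and> R i j"
    using assms unfolding adj_def class_graph_def by (auto simp: doubleton_eq_iff)
qed (simp add: class_graph_def)

lemma contains_graphD:
  assumes "contains_graph G H"
  obtains f where "inj_on f (verts H)" "f ` verts H \<subseteq> verts G" "\<And>x y. adj H x y \<Longrightarrow> adj G (f x) (f y)"
proof -
  obtain f where f: "inj_on f (verts H)" "f ` verts H \<subseteq> verts G" "\<forall>e\<in>edges H. f ` e \<in> edges G"
    using assms unfolding contains_graph_def by blast
  have "adj G (f x) (f y)" if "adj H x y" for x y using f(3) that unfolding adj_def by fastforce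
  then show ?thesis using that f by blast
qed

lemma path_graph_props: "verts (path_graph k) = {..<k}" "Suc i < k \<Longrightarrow> adj (path_graph k) i (Suc i)"
  unfolding path_graph_def adj_def by auto

text \<open>The host consists of cliques of orders \<open>n - 1\<close> and at most
  \<open>k div 2 - 1\<close>, both too small for the connected guest. Its complement is bipartite,
  so a path on \<open>k\<close> vertices would need \<open>k div 2\<close> vertices in the second
  part.\<close>

lemma not_ramsey_two_cliques:
  assumes G: "simple_graph G" "connected_graph G" "card (verts G) = n" and k: "2 \<le> k" "k \<le> n"
    and N: "N + 2 \<le> n + k div 2"
  shows "\<not> ramsey_prop G (path_graph k) N"
proof
  assume P: "ramsey_prop G (path_graph k) N"
  define R where "R i j \<longleftrightarrow> (i < n - 1 \<longleftrightarrow> j < n - 1)" for i j :: nat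
  have sR: "\<And>i j. R i j \<Longrightarrow> R j i" unfolding R_def by blast
  let ?\<Gamma> = "class_graph N R"
  have cg: "verts ?\<Gamma> = {..<N}" "simple_graph ?\<Gamma>" "\<And>i j. adj ?\<Gamma> i j \<longleftrightarrow> i < N \<and> j < N \<and> i \<noteq> j \<and> R i j"
    by (rule class_graph_props, rule sR, assumption)+
  have finVG: "finite (verts G)" using G unfolding simple_graph_def by blast
  have "contains_graph ?\<Gamma> G \<or> contains_graph (complement_graph ?\<Gamma>) (path_graph k)"
    using P cg(1,2) unfolding ramsey_prop_def by auto
  then show False
  proof
    assume "contains_graph ?\<Gamma> G"
    then obtain f where f: "inj_on f (verts G)" "f ` verts G \<subseteq> verts ?\<Gamma>"
      "\<And>x y. adj G x y \<Longrightarrow> adj ?\<Gamma> (f x) (f y)" by (rule contains_graphD) blast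
    define T where "T = {x \<in> verts G. f x < n - 1}"
    have "T = {} \<or> T = verts G"
    proof (rule ccontr)
      assume "\<not> ?thesis"
      then obtain x y where xy: "x \<in> T" "y \<in> verts G - T" "adj G x y"
        using connected_crossing_edge[OF G(1,2), of T] unfolding T_def by auto
      have "R (f x) (f y)" using f(3)[OF xy(3)] cg(3) by blast
      then show False using xy(1,2) unfolding R_def T_def by auto
    qed
    then show False
    proof
      assume T: "T = {}"
      have "f ` verts G \<subseteq> {n - 1..<N}"
      proof
        fix w assume "w \<in> f ` verts G"
        then obtain x where x: "x \<in> verts G" "w = f x" by blast
        then have "x \<notin> T" using T by blast
        then show "w \<in> {n - 1..<N}" using x f(2) unfolding cg(1) T_def by auto
      qed
      then have "card (f ` verts G) \<le> card {n - 1..<N}" by (intro card_mono) auto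
      then show False using f(1) G(3) N k by (simp add: card_image)
    next
      assume T: "T = verts G"
      have "f ` verts G \<subseteq> {..<n - 1}" using T unfolding T_def by auto
      then have "card (f ` verts G) \<le> card {..<n - 1}" by (intro card_mono) auto
      then show False using f(1) G(3) k by (simp add: card_image)
    qed
  next
    assume "contains_graph (complement_graph ?\<Gamma>) (path_graph k)"
    then obtain f where f: "inj_on f {..<k}" "f ` {..<k} \<subseteq> {..<N}"
      "\<And>i. Suc i < k \<Longrightarrow> adj (complement_graph ?\<Gamma>) (f i) (f (Suc i))"
      using contains_graphD path_graph_props cg(1) by (metis verts_complement)
    have alt: "f i < n - 1 \<longleftrightarrow> \<not> f (Suc i) < n - 1" if "Suc i < k" for i
      using f(3)[OF that] unfolding adj_complement cg R_def by auto
    \<comment> \<open>From each pair of positions \<open>2 * j\<close> and \<open>2 * j + 1\<close>,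
      the one lying in the second clique.\<close>
    define s where "s j = (if f (2 * j) < n - 1 then 2 * j + 1 else 2 * j)" for j
    have sk: "s j < k" if "j < k div 2" for j using that unfolding s_def by auto
    have "inj_on (\<lambda>j. f (s j)) {..<k div 2}"
    proof (rule inj_onI)
      fix i j assume ij: "i \<in> {..<k div 2}" "j \<in> {..<k div 2}" "f (s i) = f (s j)"
      then have "s i = s j" using f(1) sk by (auto dest: inj_onD)
      then show "i = j" unfolding s_def by (auto split: if_splits)
    qed
    moreover have "(\<lambda>j. f (s j)) ` {..<k div 2} \<subseteq> {n - 1..<N}"
    proof
      fix w assume "w \<in> (\<lambda>j. f (s j)) ` {..<k div 2}"
      then obtain j where j: "j < k div 2" "w = f (s j)" by blast
      have "2 * j + 1 < k" using j(1) by linarith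
      then have "\<not> f (s j) < n - 1" using alt[of "2 * j"] unfolding s_def by auto
      moreover have "f (s j) < N" using f(2) sk[OF j(1)] by auto
      ultimately show "w \<in> {n - 1..<N}" using j(2) by auto
    qed
    ultimately have "card {..<k div 2} \<le> card {n - 1..<N}"
      by (intro card_inj_on_le) auto
    then show False using N k by simp
  qed
qed

text \<open>The number of classes of size \<open>m\<close> is the residue of \<open>- N\<close> modulo \<open>m + 1\<close>.\<close>

lemma near_equal_classes:
  assumes m: "1 \<le> m" "m * m \<le> N"
  obtains c :: "nat \<Rightarrow> nat" where "\<And>i. i < N \<Longrightarrow> card {j. j < N \<and> c j = c i} \<in> {m, m + 1}"
    and "\<And>i. i < N \<Longrightarrow> (m + 1) dvd N \<Longrightarrow> card {j. j < N \<and> c j = c i} = m + 1"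
proof -
  define b where "b = (m + 1 - N mod (m + 1)) mod (m + 1)"
  have bm: "b \<le> m" unfolding b_def using mod_less_divisor[of "m + 1"] by (metis Suc_eq_plus1 less_Suc_eq_le zero_less_Suc)
  have "(N + b) mod (m + 1) = 0"
  proof -
    have "(N + b) mod (m + 1) = (N mod (m + 1) + (m + 1 - N mod (m + 1))) mod (m + 1)"
      unfolding b_def by (simp only: mod_add_right_eq mod_add_left_eq)
    also have "N mod (m + 1) + (m + 1 - N mod (m + 1)) = m + 1" by (simp add: less_imp_le)
    finally show ?thesis by simp
  qed
  then obtain q where q: "N + b = q * (m + 1)" by (metis mod_0_imp_dvd dvdE mult.commute)
  \<comment> \<open>The assumption \<open>m * m \<le> N\<close> leaves room for all \<open>b\<close>
    classes of size \<open>m\<close>.\<close>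
  have bmN: "b * m \<le> N" using m(2) bm by (meson le_trans mult_le_mono1)
  have bq: "b \<le> q"
  proof (rule ccontr)
    assume "\<not> b \<le> q"
    then have "(q + 1) * (m + 1) \<le> b * (m + 1)" by (intro mult_le_mono1) simp
    then show False using q bmN by (simp add: algebra_simps)
  qed
  define a where "a = q - b"
  have N: "N = b * m + a * (m + 1)"
  proof -
    have "q = a + b" unfolding a_def using bq by simp
    then show ?thesis using q by (simp add: algebra_simps)
  qed
  define c where "c i = (if i < b * m then i div m else b + (i - b * m) div (m + 1))" for i
  have small: "card {j. j < N \<and> c j = c i} = m" if i: "i < b * m" for i
  proof -
    define t where "t = i div m"
    have tb: "t < b" using i m(1) unfolding t_def by (simp add: less_mult_imp_div_less)
    have le: "t * m + m \<le> b * m" using mult_le_mono1[of "t + 1" b m] tb by simp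
    have "{j. j < N \<and> c j = c i} = {t * m..<t * m + m}"
    proof (intro set_eqI iffI)
      fix j assume "j \<in> {j. j < N \<and> c j = c i}"
      then have j: "c j = t" using i unfolding c_def t_def by simp
      then have "j < b * m" using tb unfolding c_def by (auto split: if_splits)
      then have "j div m = t" using j unfolding c_def by simp
      then show "j \<in> {t * m..<t * m + m}"
        using m(1) by (metis atLeastLessThan_iff div_times_less_eq_dividend dividend_less_div_times less_le_trans zero_less_one add.commute mult.commute)
    next
      fix j assume j: "j \<in> {t * m..<t * m + m}"
      then have "j < b * m" using le by simp
      moreover have "j div m = t" using j m(1) by (intro div_nat_eqI) (auto simp: mult.commute)
      ultimately show "j \<in> {j. j < N \<and> c j = c i}" using i bmN unfolding c_def t_def by simp
    qed
    then show ?thesis by simp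
  qed
  have large: "card {j. j < N \<and> c j = c i} = m + 1" if i: "\<not> i < b * m" "i < N" for i
  proof -
    define t where "t = (i - b * m) div (m + 1)"
    have ta: "t < a" using i N unfolding t_def by (simp add: less_mult_imp_div_less)
    have le: "t * (m + 1) + (m + 1) \<le> a * (m + 1)" using mult_le_mono1[of "t + 1" a "m + 1"] ta by simp
    have "{j. j < N \<and> c j = c i} = {b * m + t * (m + 1)..<b * m + t * (m + 1) + (m + 1)}"
    proof (intro set_eqI iffI)
      fix j assume "j \<in> {j. j < N \<and> c j = c i}"
      then have j: "c j = b + t" using i unfolding c_def t_def by simp
      have nj: "\<not> j < b * m"
      proof
        assume a: "j < b * m"
        then have "j div m < b" using m(1) by (simp add: less_mult_imp_div_less)
        then show False using j a unfolding c_def by simp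
      qed
      then have "(j - b * m) div (m + 1) = t" using j unfolding c_def by simp
      then have "t * (m + 1) \<le> j - b * m" "j - b * m < t * (m + 1) + (m + 1)"
        by (metis div_times_less_eq_dividend, metis add.commute dividend_less_div_times zero_less_Suc Suc_eq_plus1)
      then show "j \<in> {b * m + t * (m + 1)..<b * m + t * (m + 1) + (m + 1)}" using nj by auto
    next
      fix j assume j: "j \<in> {b * m + t * (m + 1)..<b * m + t * (m + 1) + (m + 1)}"
      have "(j - b * m) div (m + 1) = t" using j by (intro div_nat_eqI) (auto simp: mult.commute)
      then show "j \<in> {j. j < N \<and> c j = c i}" using i j le N unfolding c_def t_def by auto
    qed
    then show ?thesis by simp
  qed
  show ?thesis
  proof (rule that)
    show "card {j. j < N \<and> c j = c i} \<in> {m, m + 1}" if "i < N" for i using small large that by blast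
    show "card {j. j < N \<and> c j = c i} = m + 1" if "i < N" "(m + 1) dvd N" for i
    proof (rule large)
      have "b = 0" unfolding b_def using that(2) by simp
      then show "\<not> i < b * m" by simp
    qed (rule that(1))
  qed
qed

lemma not_ramsey_multipartite:
  assumes G: "simple_graph G" "verts G \<noteq> {}" "card (verts G) = n" and k: "3 \<le> k"
    and N: "(k - 2) * (k - 2) \<le> N"
    and small: "N + alpha' G + 3 < n + k \<or> (N + alpha' G + 3 = n + k \<and> (k - 1) dvd N)"
  shows "\<not> ramsey_prop G (path_graph k) N"
proof
  assume P: "ramsey_prop G (path_graph k) N"
  have k1: "k - 2 + 1 = k - 1" and m1: "1 \<le> k - 2" using k by simp_all
  obtain c :: "nat \<Rightarrow> nat" where c: "\<And>i. i < N \<Longrightarrow> card {j. j < N \<and> c j = c i} \<in> {k - 2, k - 1}"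
    "\<And>i. i < N \<Longrightarrow> (k - 1) dvd N \<Longrightarrow> card {j. j < N \<and> c j = c i} = k - 1"
    by (rule near_equal_classes[OF m1 N, unfolded k1]) blast
  let ?\<Gamma> = "class_graph N (\<lambda>i j. c i \<noteq> c j)"
  have cg: "verts ?\<Gamma> = {..<N}" "simple_graph ?\<Gamma>" "\<And>i j. adj ?\<Gamma> i j \<longleftrightarrow> i < N \<and> j < N \<and> i \<noteq> j \<and> c i \<noteq> c j"
    by (rule class_graph_props, simp)+
  have finVG: "finite (verts G)" using G unfolding simple_graph_def by blast
  have "contains_graph ?\<Gamma> G \<or> contains_graph (complement_graph ?\<Gamma>) (path_graph k)"
    using P cg(1,2) unfolding ramsey_prop_def by auto
  then show False
  proof
    assume "contains_graph ?\<Gamma> G"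
    then obtain f where f: "inj_on f (verts G)" "f ` verts G \<subseteq> verts ?\<Gamma>"
      "\<And>x y. adj G x y \<Longrightarrow> adj ?\<Gamma> (f x) (f y)" by (rule contains_graphD) blast
    obtain v where v: "v \<in> verts G" "alpha' G = independence_number (delete_closed_nbhd G v)"
      by (rule alpha'_attained[OF finVG G(2)])
    define K where "K = {j. j < N \<and> c j = c (f v)}"
    define S where "S = {x \<in> verts G. f x \<in> K \<and> x \<noteq> v}"
    have fvN: "f v < N" using v f(2) cg(1) by auto
    have "S \<subseteq> verts (delete_closed_nbhd G v)"
      using f(3) unfolding verts_delete S_def K_def cg(3) by fastforce
    moreover have "indep S (edges (delete_closed_nbhd G v))"
    proof -
      have "\<not> adj G x y" if "x \<in> S" "y \<in> S" for x y
        using f(3)[of x y] that unfolding S_def K_def cg(3) by auto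
      then show ?thesis unfolding indep_def using edges_delete calculation by (metis subsetD)
    qed
    moreover have "finite (verts (delete_closed_nbhd G v))" using finVG unfolding verts_delete by simp
    ultimately have cS: "card S \<le> alpha' G" unfolding v(2) by (intro independence_number_ge)
    have finS: "finite S" unfolding S_def using finVG by simp
    have "K \<subseteq> f ` (insert v S) \<union> ({..<N} - f ` verts G)" unfolding S_def K_def by auto
    then have "card K \<le> card (f ` (insert v S) \<union> ({..<N} - f ` verts G))"
      using finS by (intro card_mono) auto
    also have "\<dots> \<le> card (f ` (insert v S)) + card ({..<N} - f ` verts G)" by (rule card_Un_le)
    also have "card ({..<N} - f ` verts G) = N - n"
      using f(1,2) G(3) finVG cg(1) by (simp add: card_Diff_subset card_image)
    also have "card (f ` (insert v S)) \<le> card S + 1"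
      using card_image_le[of "insert v S" f] finS card_insert_le_m1[of "card S + 1" S v] by simp
    finally have cK: "card K \<le> card S + 1 + (N - n)" by simp
    have "card (f ` verts G) \<le> card {..<N}" using f(2) cg(1) by (intro card_mono) auto
    then have "n \<le> N" using f(1) G(3) by (simp add: card_image)
    then show False using cK cS c[OF fvN] small k unfolding K_def by auto
  next
    assume "contains_graph (complement_graph ?\<Gamma>) (path_graph k)"
    then obtain f where f: "inj_on f {..<k}" "f ` {..<k} \<subseteq> {..<N}"
      "\<And>i. Suc i < k \<Longrightarrow> adj (complement_graph ?\<Gamma>) (f i) (f (Suc i))"
      using contains_graphD path_graph_props cg(1) by (metis verts_complement)
    have same: "c (f i) = c (f 0)" if "i < k" for i
      using that
    proof (induction i)
      case (Suc i)
      have "c (f i) = c (f (Suc i))" using f(3)[OF Suc.prems] unfolding adj_complement cg by auto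
      then show ?case using Suc by simp
    qed simp
    have "f 0 \<in> f ` {..<k}" using k by simp
    then have f0: "f 0 < N" using f(2) by blast
    have "f ` {..<k} \<subseteq> {j. j < N \<and> c j = c (f 0)}" using f(2) same by auto
    then have "card (f ` {..<k}) \<le> card {j. j < N \<and> c j = c (f 0)}" by (intro card_mono) auto
    then show False using f(1) c(1)[OF f0] k by (auto simp: card_image)
  qed
qed

section \<open>The upper bound and the exact value\<close>

lemma ramsey_upper:
  assumes G: "simple_graph G" "connected_graph G" "card (verts G) = n"
    and k: "2 \<le> k" "20 * k\<^sup>2 \<le> n"
    and e: "real (card (edges G)) \<le> (1 + 1 / (54 * (real k)\<^sup>2)) * real n"
    and N: "n + k div 2 \<le> N + 1" "N \<le> n + k"
    and a: "n + k \<le> N + alpha' G + 2 \<or> (n + k = N + alpha' G + 3 \<and> \<not> (k - 1) dvd N)"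
  shows "ramsey_prop G (path_graph k) N"
  unfolding ramsey_prop_def
proof (intro allI impI)
  fix \<Gamma> :: "nat ugraph" assume Ga: "simple_graph \<Gamma> \<and> card (verts \<Gamma>) = N"
  have finVG: "finite (verts G)" using G unfolding simple_graph_def by blast
  let ?B = "adj (complement_graph \<Gamma>)"
  define l where "l = int (card (edges G)) - int n"
  show "contains_graph \<Gamma> G \<or> contains_graph (complement_graph \<Gamma>) (path_graph k)"
  proof (rule disjCI)
    assume no: "\<not> contains_graph (complement_graph \<Gamma>) (path_graph k)"
    \<comment> \<open>The real edge bound is turned into the integer form used by
      \<open>packing\<close>.\<close>
    have l: "54 * (int k * int k) * l \<le> int n"
    proof -
      have kp: "0 < 54 * (real k)\<^sup>2" using k by simp
      have "real (card (edges G)) - real n \<le> real n / (54 * (real k)\<^sup>2)" using e by (simp add: algebra_simps)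
      then have "54 * (real k)\<^sup>2 * (real (card (edges G)) - real n) \<le> real n"
        using kp by (simp add: pos_le_divide_eq mult.commute)
      then have "real_of_int (54 * (int k * int k) * l) \<le> real_of_int (int n)"
        unfolding l_def by (simp add: power2_eq_square)
      then show ?thesis by (simp only: of_int_le_iff)
    qed
    have "packing (verts G) (adj G) l (verts \<Gamma>) ?B k (k div 2)"
      unfolding packing_def packing_axioms_def
      using sparse_graph_adj[OF G(1,2)] path_free_complement[OF _ no k(1)] Ga G(3) k N l
      unfolding l_def by (simp add: power2_eq_square)
    then interpret packing "verts G" "adj G" l "verts \<Gamma>" ?B k "k div 2" .
    have "\<exists>h. emb (adj G) ?B (verts \<Gamma>) h (verts G)"
    proof (rule embed_guest)
      fix v assume v: "v \<in> verts G"
      have "finite (verts (delete_closed_nbhd G v))" using finVG unfolding verts_delete by simp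
      then obtain I where I: "I \<subseteq> verts (delete_closed_nbhd G v)" "indep I (edges (delete_closed_nbhd G v))"
        "card I = independence_number (delete_closed_nbhd G v)"
        by (rule independence_number_attained)
      have aI: "alpha' G \<le> card I" using alpha'_le[OF finVG v] I(3) by simp
      have "\<not> adj G x y" if "x \<in> I" "y \<in> I" for x y
      proof (cases "x = y")
        case True
        then show ?thesis using simple_graph_adjD(3)[OF G(1)] by blast
      next
        case False
        then have "{x, y} \<notin> edges (delete_closed_nbhd G v)" using I(2) that unfolding indep_def by blast
        then show ?thesis using edges_delete I(1) that by (metis subsetD)
      qed
      moreover have "I \<subseteq> verts G" "v \<notin> I" "\<forall>x\<in>I. \<not> adj G v x" using I(1) unfolding verts_delete by auto
      moreover have "card (verts G) + k \<le> card (verts \<Gamma>) + card I + 2 \<or>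
        (card (verts G) + k \<le> card (verts \<Gamma>) + card I + 3 \<and> \<not> (k - 1) dvd card (verts \<Gamma>))"
        using a aI Ga G(3) by auto
      ultimately show "\<exists>I\<subseteq>verts G. v \<notin> I \<and> (\<forall>x\<in>I. \<not> adj G v x) \<and> (\<forall>x\<in>I. \<forall>y\<in>I. \<not> adj G x y) \<and>
        (card (verts G) + k \<le> card (verts \<Gamma>) + card I + 2 \<or>
         (card (verts G) + k \<le> card (verts \<Gamma>) + card I + 3 \<and> \<not> (k - 1) dvd card (verts \<Gamma>)))"
        by blast
    qed
    then obtain h where h: "emb (adj G) ?B (verts \<Gamma>) h (verts G)" by blast
    show "contains_graph \<Gamma> G"
      unfolding contains_graph_def
    proof (intro exI[of _ h] conjI ballI)
      show inj: "inj_on h (verts G)" and im: "h ` verts G \<subseteq> verts \<Gamma>" using h unfolding emb_def by auto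
      fix e assume "e \<in> edges G"
      then obtain x y where xy: "e = {x, y}" "adj G x y" by (rule simple_graph_edgeE[OF G(1)])
      have V: "x \<in> verts G" "y \<in> verts G" "x \<noteq> y" using simple_graph_adjD[OF G(1) xy(2)] by auto
      have "h x \<noteq> h y" using inj V by (meson inj_onD)
      moreover have "\<not> ?B (h x) (h y)" using h V xy(2) unfolding emb_def by blast
      ultimately have "adj \<Gamma> (h x) (h y)" using im V unfolding adj_complement by blast
      then show "h ` e \<in> edges \<Gamma>" unfolding xy(1) adj_def by simp
    qed
  qed
qed

theorem theorem1p7:
  fixes G :: "'a ugraph" and k n :: nat and \<gamma> :: int
  assumes "k \<ge> 2" and "n \<ge> 20 * k^2"
    and "simple_graph G" and "connected_graph G"
    and "card (verts G) = n"
    and "real (card (edges G)) \<le> (1 + 1 / (54 * (real k)^2)) * real n"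
    and "\<gamma> = (if (int k - 1) dvd (int n + int k - 3 - int (alpha' G)) then 0 else 1)"
  shows "int (ramsey_number G (path_graph k)) =
    max (int n + \<lfloor>real k / 2\<rfloor> - 1)
        (int n + int k - 2 - int (alpha' G) - \<gamma>)"
proof -
  note k = assms(1) and n20 = assms(2) and G = assms(3-5)
  define a where "a = alpha' G"
  define r where "r = k div 2"
  have fl: "\<lfloor>real k / 2\<rfloor> = int r" unfolding r_def using floor_divide_of_nat_eq[of k 2] by simp
  have r: "1 \<le> r" "2 * r \<le> k" using k unfolding r_def by auto
  have \<gamma>01: "\<gamma> = 0 \<or> \<gamma> = 1" using assms(7) by simp
  have kk: "k * 2 \<le> k * k" using k by simp
  have nkk: "20 * (k * k) \<le> n" using n20 by (simp add: power2_eq_square)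
  have kn: "k \<le> n" using kk nkk by linarith
  have dv: "(int k - 1) dvd int m \<longleftrightarrow> (k - 1) dvd m" for m
  proof -
    have "int k - 1 = int (k - 1)" using k by simp
    then show ?thesis by (simp only: int_dvd_int_iff)
  qed
  define M where "M = max (int n + int r - 1) (int n + int k - 2 - int a - \<gamma>)"
  have M1: "1 \<le> M" using r kn k unfolding M_def by linarith
  define N0 where "N0 = nat M"
  have N0: "int N0 = M" unfolding N0_def using M1 by simp
  have upper: "ramsey_prop G (path_graph k) N0"
  proof (rule ramsey_upper[OF G k n20 assms(6)])
    show "n + k div 2 \<le> N0 + 1" using N0 unfolding M_def r_def by linarith
    show "N0 \<le> n + k" using N0 r \<gamma>01 unfolding M_def by linarith
    show "n + k \<le> N0 + alpha' G + 2 \<or> (n + k = N0 + alpha' G + 3 \<and> \<not> (k - 1) dvd N0)"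
    proof (cases "n + k \<le> N0 + alpha' G + 2")
      case False
      \<comment> \<open>\<open>N0\<close> can fall short here only if it is exactly the number whose
        divisibility defines \<open>\<gamma>\<close>.\<close>
      then have eq: "n + k = N0 + alpha' G + 3" and "\<gamma> = 1" using N0 \<gamma>01 unfolding M_def a_def by linarith+
      then have "\<not> (int k - 1) dvd (int n + int k - 3 - int (alpha' G))" using assms(7) by auto
      moreover have "int n + int k - 3 - int (alpha' G) = int N0" using eq by linarith
      ultimately have "\<not> (k - 1) dvd N0" using dv by simp
      then show ?thesis using eq by simp
    qed simp
  qed
  have lower: "N0 \<le> N" if P: "ramsey_prop G (path_graph k) N" for N
  proof -
    have 1: "n + r \<le> N + 1"
      using not_ramsey_two_cliques[OF G k kn, of N] P unfolding r_def by linarith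
    have "int n + int k - 2 - int a - \<gamma> \<le> int N"
    proof (rule ccontr)
      assume c: "\<not> ?thesis"
      \<comment> \<open>One less than the second term of the maximum, the order of the multipartite
        host.\<close>
      define L where "L = nat (int n + int k - 3 - int a - \<gamma>)"
      have L: "int L = int n + int k - 3 - int a - \<gamma>" using c unfolding L_def by linarith
      have NL: "N \<le> L" using c L by linarith
      \<comment> \<open>For \<open>k = 2\<close> the second term never exceeds the first.\<close>
      have k3: "3 \<le> k" using NL L 1 r \<gamma>01 by linarith
      have "ramsey_prop G (path_graph k) L" using ramsey_prop_mono[OF P NL] .
      moreover have "\<not> ramsey_prop G (path_graph k) L"
      proof (rule not_ramsey_multipartite[OF G(1) _ G(3) k3])
        show "verts G \<noteq> {}" using G(2) unfolding connected_graph_def by blast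
        have "(k - 2) * (k - 2) \<le> k * k" by (intro mult_le_mono) auto
        then show "(k - 2) * (k - 2) \<le> L" using nkk 1 r NL by linarith
        show "L + alpha' G + 3 < n + k \<or> (L + alpha' G + 3 = n + k \<and> (k - 1) dvd L)"
        \<comment> \<open>For \<open>\<gamma> = 0\<close>, \<open>L\<close> is the number tested for
          divisibility and all classes have size \<open>k - 1\<close>; for
          \<open>\<gamma> = 1\<close>, \<open>L\<close> is smaller by one and classes of size
          \<open>k - 2\<close> suffice.\<close>
        proof (cases "\<gamma> = 0")
          case True
          have "(int k - 1) dvd (int n + int k - 3 - int (alpha' G))"
            by (rule ccontr) (use assms(7) True in simp)
          moreover have "int n + int k - 3 - int (alpha' G) = int L" using L True unfolding a_def by linarith
          ultimately have "(k - 1) dvd L" using dv by simp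
          moreover have "L + alpha' G + 3 = n + k" using L True unfolding a_def by linarith
          ultimately show ?thesis by simp
        next
          case False
          then show ?thesis using L \<gamma>01 unfolding a_def by linarith
        qed
      qed
      ultimately show False by simp
    qed
    then show ?thesis using 1 N0 unfolding M_def by linarith
  qed
  have "ramsey_number G (path_graph k) = N0"
    unfolding ramsey_number_def ramsey_prop_def[symmetric]
    by (rule Least_equality) (use upper lower N0 M1 in auto)
  then show ?thesis using N0 unfolding M_def fl a_def by simp
qed

end
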